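(* Let $\varphi$ be an $\omega$-regular winning condition and let $\psi_\varphi\in\mathcal L^{sys}_\mu$ be a closed formula that matches $\varphi$. Let $G^w=\langle\mathcal V,\mathcal X,\mathcal Y,\rho^e,\rho^s,\varphi,w^s\rangle$ be a weighted game structure whose winning condition is $\varphi$, and let $c\in\mathbb N$ be a finite upper bound. Then for every state $s\in 2^{\mathcal V}$: if $[\![\psi_\varphi^{E}]\!]^{G^w(c)}(s)\neq+\infty$, then $[\![\psi_\varphi^{E}]\!]^{G^w(c)}(s)$ is the minimum initial credit for which the system wins from $s$ w.r.t. $c$ in $G^w$; otherwise, $s$ does not win for the system w.r.t. $c$ (for any initial credit in $[0,c]$).
   Context: Game structures. A game structure (GS) is $G=\langle\mathcal V,\mathcal X,\mathcal Y,\rho^e,\rho^s,\varphi\rangle$: $\mathcal V$ is a finite set of Boolean variables, $\mathcal X\subseteq\mathcal V$ are input variables (controlled by the environment), $\mathcal Y=\mathcal V\setminus\mathcal X$ are output variables (controlled by the system). States are assignments $s\in2^{\mathcal V}$; $p(s)$ denotes the copy of an assignment over primed variables $\mathcal V'=\{v'\mid v\in\mathcal V\}$; assignments to disjoint variable sets are combined by union and written as tuples. $\rho^e$ is a propositional formula over $\mathcal V\cup\mathcal X'$, $\rho^s$ over $\mathcal V\cup\mathcal V'$, and $\varphi$ is an $\omega$-regular condition on infinite state sequences. In each round, from state $s$ the environment chooses an input $s_{\mathcal X}$ with $(s,p(s_{\mathcal X}))\models\rho^e$, then the system chooses an output $s_{\mathcal Y}$ with $(s,p(s_{\mathcal X}),p(s_{\mathcal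 Y}))\models\rho^s$, and the next state is $(s_{\mathcal X},s_{\mathcal Y})$. A play is infinite, or finite ending in a deadlock for the environment (no valid input) or for the system (a valid input was chosen but no valid output exists). A play wins for the system (qualitatively) if it is finite and ends in a deadlock for the environment, or it is infinite and satisfies $\varphi$. Strategies (for the system: partial functions $(2^{\mathcal V})^+2^{\mathcal X}\to2^{\mathcal Y}$ respecting $\rho^s$; for the environment: partial functions $(2^{\mathcal V})^+\to2^{\mathcal X}$ respecting $\rho^e$), consistency of plays with strategies, and strategies "from $s$" (defined on all consistent histories from $s$) are as usual. Weighted game structures and energy. A WGS $G^w=\langle\mathcal V,\mathcal X,\mathcal Y,\rho^e,\rho^s,\varphi,w^s\rangle$ is a GS with a partial weight function $w^s:2^{\mathcal V\cup\mathcal V'}\to\mathbb Z$ defined on $\rho^s$-transitions. For an upper bound $c\in\mathbb N\cup\{+\infty\}$ and an initial credit $c_0\in\mathbb N$ with $c_0\le c$, the energy level of a prefix $s_0\ldots s_k$ is $r_k$, where $r_0=c_0$ and $r_i=\min(c,r_{i-1}+w^s(s_{i-1},p(s_i)))$. A play wins the $\varphi$-energy objective w.r.t. $c$ for $c_0$ if it wins for the system qualitatively and every prefix has non-negative energy level. A system strategy wins from $s$ w.r.t. $c$ for $c_0$ if it is a strategy from $s$ and all consistent plays from $s$ win the $\varphi$-energy objective w.r.t. $c$ for $c_0$; the system wins from $s$ w.r.t. $c$ for $c_0$ if such a strategy exists. $\mu$-calculus. Formulas: $\psi::=v\mid\neg v\mid X\mid\psi\vee\psi\mid\psi\wedge\psi\mid\Diamond\psi\mid\Box\psi\mid\mu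 X\psi\mid\nu X\psi$ ($v\in\mathcal V$, $X$ a relational variable). Over a GS, $[\![\psi]\!]^G_{\mathcal E}\subseteq2^{\mathcal V}$ (for a valuation $\mathcal E$ of relational variables by sets of states) is standard for literals, variables, $\vee$ (union), $\wedge$ (intersection), least/greatest fixed points; $[\![\Diamond\phi]\!]$ is the set of $s$ such that for every $s_{\mathcal X}$ with $(s,p(s_{\mathcal X}))\models\rho^e$ there is $s_{\mathcal Y}$ with $(s,p(s_{\mathcal X}),p(s_{\mathcal Y}))\models\rho^s$ and $(s_{\mathcal X},s_{\mathcal Y})\in[\![\phi]\!]$; $[\![\Box\phi]\!]$ is the set of $s$ for which some $s_{\mathcal X}$ with $(s,p(s_{\mathcal X}))\models\rho^e$ satisfies that every $s_{\mathcal Y}$ with $(s,p(s_{\mathcal X}),p(s_{\mathcal Y}))\models\rho^s$ has $(s_{\mathcal X},s_{\mathcal Y})\in[\![\phi]\!]$. $\mathcal L^{sys}_\mu$ is the set of formulas with no $\Box$. A closed $\psi\in\mathcal L^{sys}_\mu$ matches $\varphi$ if for every GS $G$ with winning condition $\varphi$, $[\![\psi]\!]^G$ is exactly the set of states from which the system has a (qualitatively) winning strategy. Energy $\mu$-calculus. $\psi^E$ is obtained from $\psi$ by replacing $\Diamond$ with $\Diamond_E$ and $\Box$ with $\Box_E$. For $c\in\mathbb N$, let $E(c)=\{0,\ldots,c\}\cup\{+\infty\}$ and $EF(c)$ the set of functions $2^{\mathcal V}\to E(c)$; $f_x$ is the constant function $x$. Define $EC_c((s,s'),e)$ for $s\in2^{\mathcal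 V},s'\in2^{\mathcal V'},e\in E(c)$ as: $0$ if $(s,s')\not\models\rho^e$; else $+\infty$ if $e=+\infty$ or $(s,s')\models\neg\rho^s$; else $+\infty$ if $e-w^s(s,s')>c$; else $\max(0,e-w^s(s,s'))$. Define $ECpre_{sys}(f)(s)=\max_{s_{\mathcal X}\in2^{\mathcal X}}\min_{s_{\mathcal Y}\in2^{\mathcal Y}}EC_c((s,p(s_{\mathcal X},s_{\mathcal Y})),f(s_{\mathcal X},s_{\mathcal Y}))$ (usual order, $+\infty$ largest). Negation $\sim$ on $E(c)$: $\sim0=+\infty$, $\sim(+\infty)=0$, $\sim x=c+1-x$ otherwise (pointwise on $EF(c)$). The semantics $[\![\psi]\!]^{G^w(c)}_{\mathcal D}\in EF(c)$ for a valuation $\mathcal D$ of relational variables in $EF(c)$: $[\![v]\!](s)=0$ if $s\models v$ and $+\infty$ otherwise; $[\![\neg v]\!](s)=+\infty$ if $s\models v$ and $0$ otherwise; $[\![X]\!]=\mathcal D(X)$; $\vee$ is pointwise $\min$; $\wedge$ is pointwise $\max$; $[\![\Diamond_E\phi]\!]=ECpre_{sys}([\![\phi]\!])$; $[\![\Box_E\phi]\!]=\sim ECpre_{sys}(\sim[\![\phi]\!])$; $[\![\mu X\phi]\!]=\min_i h_i$ (pointwise) where $h_0=f_{+\infty}$, $h_{i+1}=[\![\phi]\!]_{\mathcal D[X\mapsto h_i]}$; $[\![\nu X\phi]\!]=\max_i h_i$ where $h_0=f_0$ and $h_{i+1}$ as before. For closed formulas the valuation is omitted. *)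

theory Defs
  imports Complex_Main "HOL-Library.Extended_Nat" "HOL-Library.Infinite_Typeclass"
begin

section \<open>Propositional formulas over unprimed and primed variables\<close>

text \<open>Assignments are identified with the sets of variables that they make true. In particular
  the states over the variables \<open>V\<close> are the subsets of \<open>V\<close>, and the union of
  assignments to disjoint sets of variables is the union of sets.\<close>

datatype (patoms: 'a) pform =
    PTrue
  | PVar 'a
  | PNot "'a pform"
  | PAnd "'a pform" "'a pform"
  | POr "'a pform" "'a pform"

primrec sat :: "'a set \<Rightarrow> 'a pform \<Rightarrow> bool" where
  "sat I PTrue = True"
| "sat I (PVar a) = (a \<in> I)"
| "sat I (PNot f) = (\<not> sat I f)"
| "sat I (PAnd f g) = (sat I f \<and> sat I g)"
| "sat I (POr f g) = (sat I f \<or> sat I g)"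

datatype 'v pvar = Unprimed 'v | Primed 'v

text \<open>The assignment \<open>(s, p(t))\<close>, where \<open>t\<close> may be a full or a partial
  successor assignment.\<close>

definition step :: "'v set \<Rightarrow> 'v set \<Rightarrow> 'v pvar set" where
  "step s t = Unprimed ` s \<union> Primed ` t"


section \<open>Omega-regular conditions\<close>

text \<open>A winning condition is a set of infinite sequences of assignments to the whole supply
  \<open>'v\<close> of variables. It is an omega-regular condition over the finite set \<open>A\<close> of
  variables if membership of a sequence depends only on its projection to \<open>A\<close> and the
  projections form the language of a nondeterministic Buechi automaton over the alphabet
  \<open>Pow A\<close>. So one and the same condition can be used in game structures with
  different sets of variables, as long as these contain the variables that it is about.\<close>

definition omega_regular_over :: "'v set \<Rightarrow> (nat \<Rightarrow> 'v set) set \<Rightarrow> bool" where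
  "omega_regular_over A \<phi> \<longleftrightarrow> finite A \<and>
     (\<exists>(Q :: nat set) I \<Delta> F. finite Q \<and> I \<subseteq> Q \<and> \<Delta> \<subseteq> Q \<times> Pow A \<times> Q \<and> F \<subseteq> Q \<and>
        (\<forall>\<sigma>. \<sigma> \<in> \<phi> \<longleftrightarrow>
           (\<exists>run. run 0 \<in> I \<and> (\<forall>i. (run i, \<sigma> i \<inter> A, run (Suc i)) \<in> \<Delta>) \<and>
              (\<forall>i. \<exists>j\<ge>i. run j \<in> F))))"

definition omega_regular :: "(nat \<Rightarrow> 'v set) set \<Rightarrow> bool" where
  "omega_regular \<phi> \<longleftrightarrow> (\<exists>A. omega_regular_over A \<phi>)"


section \<open>Game structures\<close>

record 'v gs =
  gvars :: "'v set"
  inputs :: "'v set"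
  rho_e :: "'v pvar pform"
  rho_s :: "'v pvar pform"
  wincond :: "(nat \<Rightarrow> 'v set) set"

record 'v wgs = "'v gs" +
  weight :: "'v pvar set \<rightharpoonup> int"

definition outputs :: "('v, 'z) gs_scheme \<Rightarrow> 'v set" where
  "outputs G = gvars G - inputs G"

definition states :: "('v, 'z) gs_scheme \<Rightarrow> 'v set set" where
  "states G = Pow (gvars G)"

definition game_structure :: "('v, 'z) gs_scheme \<Rightarrow> bool" where
  "game_structure G \<longleftrightarrow>
     finite (gvars G) \<and> inputs G \<subseteq> gvars G \<and>
     patoms (rho_e G) \<subseteq> Unprimed ` gvars G \<union> Primed ` inputs G \<and>
     patoms (rho_s G) \<subseteq> Unprimed ` gvars G \<union> Primed ` gvars G \<and>
     omega_regular_over (gvars G) (wincond G)"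

definition weighted_game_structure :: "'v wgs \<Rightarrow> bool" where
  "weighted_game_structure G \<longleftrightarrow> game_structure G \<and>
     (\<forall>s\<in>states G. \<forall>t\<in>states G. sat (step s t) (rho_s G) \<longrightarrow> step s t \<in> dom (weight G))"

definition valid_input :: "('v, 'z) gs_scheme \<Rightarrow> 'v set \<Rightarrow> 'v set \<Rightarrow> bool" where
  "valid_input G s x \<longleftrightarrow> x \<subseteq> inputs G \<and> sat (step s x) (rho_e G)"

definition valid_output :: "('v, 'z) gs_scheme \<Rightarrow> 'v set \<Rightarrow> 'v set \<Rightarrow> 'v set \<Rightarrow> bool" where
  "valid_output G s x y \<longleftrightarrow> y \<subseteq> outputs G \<and> sat (step s (x \<union> y)) (rho_s G)"

definition gs_step :: "('v, 'z) gs_scheme \<Rightarrow> 'v set \<Rightarrow> 'v set \<Rightarrow> bool" where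
  "gs_step G s t \<longleftrightarrow> t \<in> states G \<and> valid_input G s (t \<inter> inputs G) \<and>
     valid_output G s (t \<inter> inputs G) (t \<inter> outputs G)"


section \<open>Plays\<close>

text \<open>A finite play records who is in deadlock; a deadlock for the system also records the
  valid input that admits no valid output.\<close>

datatype 'v play =
    Infinite "nat \<Rightarrow> 'v set"
  | Env_Deadlock "'v set list"
  | Sys_Deadlock "'v set list" "'v set"

definition history_from :: "('v, 'z) gs_scheme \<Rightarrow> 'v set \<Rightarrow> 'v set list \<Rightarrow> bool" where
  "history_from G s h \<longleftrightarrow> h \<noteq> [] \<and> hd h = s \<and> set h \<subseteq> states G \<and>
     (\<forall>i. Suc i < length h \<longrightarrow> gs_step G (h ! i) (h ! Suc i))"

primrec prefixes :: "'v play \<Rightarrow> 'v set list set" where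
  "prefixes (Infinite \<sigma>) = {map \<sigma> [0..<n] | n. 0 < n}"
| "prefixes (Env_Deadlock h) = {take n h | n. 0 < n \<and> n \<le> length h}"
| "prefixes (Sys_Deadlock h x) = {take n h | n. 0 < n \<and> n \<le> length h}"

primrec play_from :: "('v, 'z) gs_scheme \<Rightarrow> 'v set \<Rightarrow> 'v play \<Rightarrow> bool" where
  "play_from G s (Infinite \<sigma>) \<longleftrightarrow>
     \<sigma> 0 = s \<and> s \<in> states G \<and> (\<forall>i. gs_step G (\<sigma> i) (\<sigma> (Suc i)))"
| "play_from G s (Env_Deadlock h) \<longleftrightarrow>
     history_from G s h \<and> (\<forall>x. \<not> valid_input G (last h) x)"
| "play_from G s (Sys_Deadlock h x) \<longleftrightarrow>
     history_from G s h \<and> valid_input G (last h) x \<and> (\<forall>y. \<not> valid_output G (last h) x y)"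

primrec play_wins :: "('v, 'z) gs_scheme \<Rightarrow> 'v play \<Rightarrow> bool" where
  "play_wins G (Infinite \<sigma>) \<longleftrightarrow> \<sigma> \<in> wincond G"
| "play_wins G (Env_Deadlock h) \<longleftrightarrow> True"
| "play_wins G (Sys_Deadlock h x) \<longleftrightarrow> False"


section \<open>System strategies\<close>

type_synonym 'v strategy = "'v set list \<Rightarrow> 'v set \<Rightarrow> 'v set option"

definition sys_strategy :: "('v, 'z) gs_scheme \<Rightarrow> 'v strategy \<Rightarrow> bool" where
  "sys_strategy G f \<longleftrightarrow>
     (\<forall>h x y. f h x = Some y \<longrightarrow>
        h \<noteq> [] \<and> set h \<subseteq> states G \<and> x \<subseteq> inputs G \<and> valid_output G (last h) x y)"

definition history_consistent ::
  "('v, 'z) gs_scheme \<Rightarrow> 'v strategy \<Rightarrow> 'v set list \<Rightarrow> bool" where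
  "history_consistent G f h \<longleftrightarrow>
     (\<forall>i. Suc i < length h \<longrightarrow>
        f (take (Suc i) h) (h ! Suc i \<inter> inputs G) = Some (h ! Suc i \<inter> outputs G))"

definition play_consistent :: "('v, 'z) gs_scheme \<Rightarrow> 'v strategy \<Rightarrow> 'v play \<Rightarrow> bool" where
  "play_consistent G f \<pi> \<longleftrightarrow> (\<forall>h\<in>prefixes \<pi>. history_consistent G f h)"

text \<open>A strategy from \<open>s\<close> is defined after every consistent history from \<open>s\<close> and
  every valid input, unless the system is then in deadlock, where a strategy that respects
  \<open>rho_s\<close> cannot be defined.\<close>

definition sys_strategy_from ::
  "('v, 'z) gs_scheme \<Rightarrow> 'v set \<Rightarrow> 'v strategy \<Rightarrow> bool" where
  "sys_strategy_from G s f \<longleftrightarrow> sys_strategy G f \<and>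
     (\<forall>h x. history_from G s h \<and> history_consistent G f h \<and> valid_input G (last h) x \<and>
        (\<exists>y. valid_output G (last h) x y) \<longrightarrow> f h x \<noteq> None)"

definition sys_wins :: "('v, 'z) gs_scheme \<Rightarrow> 'v set \<Rightarrow> bool" where
  "sys_wins G s \<longleftrightarrow> (\<exists>f. sys_strategy_from G s f \<and>
     (\<forall>\<pi>. play_from G s \<pi> \<and> play_consistent G f \<pi> \<longrightarrow> play_wins G \<pi>))"


section \<open>The energy objective\<close>

definition cap :: "enat \<Rightarrow> int \<Rightarrow> int" where
  "cap c r = (case c of enat n \<Rightarrow> min (int n) r | \<infinity> \<Rightarrow> r)"

primrec energy_at :: "'v wgs \<Rightarrow> enat \<Rightarrow> nat \<Rightarrow> 'v set list \<Rightarrow> nat \<Rightarrow> int" where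
  "energy_at G c c0 h 0 = int c0"
| "energy_at G c c0 h (Suc i) =
     cap c (energy_at G c c0 h i + the (weight G (step (h ! i) (h ! Suc i))))"

definition energy_level :: "'v wgs \<Rightarrow> enat \<Rightarrow> nat \<Rightarrow> 'v set list \<Rightarrow> int" where
  "energy_level G c c0 h = energy_at G c c0 h (length h - 1)"

definition play_wins_energy :: "'v wgs \<Rightarrow> enat \<Rightarrow> nat \<Rightarrow> 'v play \<Rightarrow> bool" where
  "play_wins_energy G c c0 \<pi> \<longleftrightarrow> play_wins G \<pi> \<and> (\<forall>h\<in>prefixes \<pi>. 0 \<le> energy_level G c c0 h)"

definition sys_wins_energy :: "'v wgs \<Rightarrow> enat \<Rightarrow> nat \<Rightarrow> 'v set \<Rightarrow> bool" where
  "sys_wins_energy G c c0 s \<longleftrightarrow> (\<exists>f. sys_strategy_from G s f \<and>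
     (\<forall>\<pi>. play_from G s \<pi> \<and> play_consistent G f \<pi> \<longrightarrow> play_wins_energy G c c0 \<pi>))"

text \<open>Initial credits range over the natural numbers up to \<open>c\<close>.\<close>

definition winning_credits :: "'v wgs \<Rightarrow> enat \<Rightarrow> 'v set \<Rightarrow> nat set" where
  "winning_credits G c s = {c0. enat c0 \<le> c \<and> sys_wins_energy G c c0 s}"


section \<open>The modal mu-calculus\<close>

datatype (mu_vars: 'v, 'x) mu =
    MVar 'v
  | MNegVar 'v
  | MRel 'x
  | MOr "('v, 'x) mu" "('v, 'x) mu"
  | MAnd "('v, 'x) mu" "('v, 'x) mu"
  | MDia "('v, 'x) mu"
  | MBox "('v, 'x) mu"
  | Mu 'x "('v, 'x) mu"
  | Nu 'x "('v, 'x) mu"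

primrec free_rels :: "('v, 'x) mu \<Rightarrow> 'x set" where
  "free_rels (MVar v) = {}"
| "free_rels (MNegVar v) = {}"
| "free_rels (MRel X) = {X}"
| "free_rels (MOr a b) = free_rels a \<union> free_rels b"
| "free_rels (MAnd a b) = free_rels a \<union> free_rels b"
| "free_rels (MDia a) = free_rels a"
| "free_rels (MBox a) = free_rels a"
| "free_rels (Mu X a) = free_rels a - {X}"
| "free_rels (Nu X a) = free_rels a - {X}"

definition closed_mu :: "('v, 'x) mu \<Rightarrow> bool" where
  "closed_mu \<psi> \<longleftrightarrow> free_rels \<psi> = {}"

primrec sys_mu :: "('v, 'x) mu \<Rightarrow> bool" where
  "sys_mu (MVar v) = True"
| "sys_mu (MNegVar v) = True"
| "sys_mu (MRel X) = True"
| "sys_mu (MOr a b) = (sys_mu a \<and> sys_mu b)"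
| "sys_mu (MAnd a b) = (sys_mu a \<and> sys_mu b)"
| "sys_mu (MDia a) = sys_mu a"
| "sys_mu (MBox a) = False"
| "sys_mu (Mu X a) = sys_mu a"
| "sys_mu (Nu X a) = sys_mu a"

text \<open>The fixed points are taken in the lattice of subsets of \<open>states G\<close>.\<close>

primrec mu_sem ::
  "('v, 'z) gs_scheme \<Rightarrow> ('v, 'x) mu \<Rightarrow> ('x \<Rightarrow> 'v set set) \<Rightarrow> 'v set set" where
  "mu_sem G (MVar v) E = {s \<in> states G. v \<in> s}"
| "mu_sem G (MNegVar v) E = {s \<in> states G. v \<notin> s}"
| "mu_sem G (MRel X) E = E X"
| "mu_sem G (MOr a b) E = mu_sem G a E \<union> mu_sem G b E"
| "mu_sem G (MAnd a b) E = mu_sem G a E \<inter> mu_sem G b E"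
| "mu_sem G (MDia a) E = {s \<in> states G. \<forall>x. valid_input G s x \<longrightarrow>
     (\<exists>y. valid_output G s x y \<and> x \<union> y \<in> mu_sem G a E)}"
| "mu_sem G (MBox a) E = {s \<in> states G. \<exists>x. valid_input G s x \<and>
     (\<forall>y. valid_output G s x y \<longrightarrow> x \<union> y \<in> mu_sem G a E)}"
| "mu_sem G (Mu X a) E = \<Inter> {S. S \<subseteq> states G \<and> mu_sem G a (E(X := S)) \<subseteq> S}"
| "mu_sem G (Nu X a) E = \<Union> {S. S \<subseteq> states G \<and> S \<subseteq> mu_sem G a (E(X := S))}"

text \<open>For closed formulas the valuation is irrelevant.\<close>

definition mu_sem_closed :: "('v, 'z) gs_scheme \<Rightarrow> ('v, 'x) mu \<Rightarrow> 'v set set" where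
  "mu_sem_closed G \<psi> = mu_sem G \<psi> (\<lambda>_. {})"

text \<open>Matching quantifies over all game structures with winning condition \<open>\<phi>\<close>, whatever
  their variables are, provided that \<open>\<phi>\<close> (by \<^const>\<open>game_structure\<close>) and the
  formula are over these variables. The type \<open>'v\<close> should be infinite, so that it does not
  bound the number of variables of a game structure.\<close>

definition matches :: "('v :: infinite, 'x) mu \<Rightarrow> (nat \<Rightarrow> 'v set) set \<Rightarrow> bool" where
  "matches \<psi> \<phi> \<longleftrightarrow>
     (\<forall>G :: 'v gs. game_structure G \<and> wincond G = \<phi> \<and> mu_vars \<psi> \<subseteq> gvars G \<longrightarrow>
        mu_sem_closed G \<psi> = {s \<in> states G. sys_wins G s})"


section \<open>The energy mu-calculus\<close>

datatype ('v, 'x) emu =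
    EVar 'v
  | ENegVar 'v
  | ERel 'x
  | EOr "('v, 'x) emu" "('v, 'x) emu"
  | EAnd "('v, 'x) emu" "('v, 'x) emu"
  | EDia "('v, 'x) emu"
  | EBox "('v, 'x) emu"
  | EMu 'x "('v, 'x) emu"
  | ENu 'x "('v, 'x) emu"

primrec to_energy :: "('v, 'x) mu \<Rightarrow> ('v, 'x) emu" where
  "to_energy (MVar v) = EVar v"
| "to_energy (MNegVar v) = ENegVar v"
| "to_energy (MRel X) = ERel X"
| "to_energy (MOr a b) = EOr (to_energy a) (to_energy b)"
| "to_energy (MAnd a b) = EAnd (to_energy a) (to_energy b)"
| "to_energy (MDia a) = EDia (to_energy a)"
| "to_energy (MBox a) = EBox (to_energy a)"
| "to_energy (Mu X a) = EMu X (to_energy a)"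
| "to_energy (Nu X a) = ENu X (to_energy a)"

text \<open>The set \<open>{0, \<dots>, c} \<union> {\<infinity>}\<close> is represented within \<^typ>\<open>enat\<close>, and functions on states
  are total functions on \<^typ>\<open>'v set\<close> whose values outside \<open>states G\<close> play no role.\<close>

definition EC :: "'v wgs \<Rightarrow> nat \<Rightarrow> 'v pvar set \<Rightarrow> enat \<Rightarrow> enat" where
  "EC G c st e =
     (if \<not> sat st (rho_e G) then 0
      else if \<not> sat st (rho_s G) then \<infinity>
      else (case e of \<infinity> \<Rightarrow> \<infinity>
            | enat n \<Rightarrow>
                (let d = int n - the (weight G st)
                 in if d > int c then \<infinity> else enat (nat (max 0 d)))))"

definition ECpre :: "'v wgs \<Rightarrow> nat \<Rightarrow> ('v set \<Rightarrow> enat) \<Rightarrow> 'v set \<Rightarrow> enat" where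
  "ECpre G c f s =
     (MAX x\<in>Pow (inputs G). MIN y\<in>Pow (outputs G). EC G c (step s (x \<union> y)) (f (x \<union> y)))"

definition eneg :: "nat \<Rightarrow> enat \<Rightarrow> enat" where
  "eneg c e = (if e = 0 then \<infinity> else case e of \<infinity> \<Rightarrow> 0 | enat n \<Rightarrow> enat (c + 1 - n))"

text \<open>The minimum and the maximum of the approximants are written as infimum and supremum
  over all stages; both are attained, since all values lie in the finite set
  \<open>{0, \<dots>, c} \<union> {\<infinity>}\<close> whenever those of the valuation do.\<close>

primrec emu_sem ::
  "'v wgs \<Rightarrow> nat \<Rightarrow> ('v, 'x) emu \<Rightarrow> ('x \<Rightarrow> 'v set \<Rightarrow> enat) \<Rightarrow> 'v set \<Rightarrow> enat" where
  "emu_sem G c (EVar v) D = (\<lambda>s. if v \<in> s then 0 else \<infinity>)"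
| "emu_sem G c (ENegVar v) D = (\<lambda>s. if v \<in> s then \<infinity> else 0)"
| "emu_sem G c (ERel X) D = D X"
| "emu_sem G c (EOr a b) D = (\<lambda>s. min (emu_sem G c a D s) (emu_sem G c b D s))"
| "emu_sem G c (EAnd a b) D = (\<lambda>s. max (emu_sem G c a D s) (emu_sem G c b D s))"
| "emu_sem G c (EDia a) D = ECpre G c (emu_sem G c a D)"
| "emu_sem G c (EBox a) D = (\<lambda>s. eneg c (ECpre G c (\<lambda>t. eneg c (emu_sem G c a D t)) s))"
| "emu_sem G c (EMu X a) D =
     (\<lambda>s. INF i. ((\<lambda>h. emu_sem G c a (D(X := h))) ^^ i) (\<lambda>_. \<infinity>) s)"
| "emu_sem G c (ENu X a) D =
     (\<lambda>s. SUP i. ((\<lambda>h. emu_sem G c a (D(X := h))) ^^ i) (\<lambda>_. 0) s)"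

definition emu_sem_closed :: "'v wgs \<Rightarrow> nat \<Rightarrow> ('v, 'x) emu \<Rightarrow> 'v set \<Rightarrow> enat" where
  "emu_sem_closed G c \<psi> = emu_sem G c \<psi> (\<lambda>_ _. 0)"

end

theory Submission
  imports Defs
begin

text \<open>The energy level can be made part of the state: add \<open>c\<close> fresh output variables and let
  the number of true ones be a level that the system may never raise above what the
  weights allow. In this expanded game structure the condition \<open>\<phi>\<close> alone expresses the energy objective,
  and an energy function \<open>g\<close> corresponds to the set of states \<open>(s, e)\<close> with \<open>g s \<le> e\<close>. This
  correspondence commutes with all operators but \<open>MBox\<close>, so the claim reduces to the
  assumption that \<open>\<psi>\<close> matches \<open>\<phi>\<close>, applied to the expanded game.\<close>

section \<open>Propositional formulas and omega-regular conditions\<close>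

text \<open>Matching speaks of qualitative games only, so running out of energy has to become a
  qualitative loss. In the expanded game it is a deadlock: a move that would take the level below 0
  has no successor, as no level is negative. The cap is automatic, since \<open>c\<close> variables
  cannot encode a level above \<open>c\<close>. Letting the system discard energy makes its options
  monotone: a higher level offers at least the same moves. So a single threshold \<open>g s\<close>
  can describe the winning levels at \<open>s\<close>. The same monotonicity excludes
  \<open>MBox\<close>: there more moves of the system do harm, so the resulting set is closed under
  lowering the level instead of raising it. The price of using the assumption on a new game is that
  the expansion must be a genuine game structure: \<phi> has to remain a condition over the larger
  set of variables, and the new transition relation has to be a formula.\<close>

lemma sat_cong:
  "(\<And>a. a \<in> patoms f \<Longrightarrow> a \<in> I \<longleftrightarrow> a \<in> J) \<Longrightarrow> sat I f = sat J f"
  by (induction f) auto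

text \<open>Shannon expansion, one variable of \<open>A\<close> at a time. It turns a semantic
  condition into an actual formula, which \<open>rho_s\<close> must be although weights are
  arbitrary functions.\<close>

lemma ex_pform:
  "finite A \<Longrightarrow> \<exists>f. patoms f \<subseteq> A \<and> (\<forall>I. sat I f = P (I \<inter> A))"
proof (induction A arbitrary: P rule: finite_induct)
  case empty
  show ?case
    by (rule exI[of _ "if P {} then PTrue else PNot PTrue"]) auto
next
  case (insert a A)
  obtain f where f: "patoms f \<subseteq> A" "\<And>I. sat I f = P (insert a (I \<inter> A))"
    using insert.IH[of "\<lambda>I. P (insert a I)"] by blast
  obtain g where g: "patoms g \<subseteq> A" "\<And>I. sat I g = P (I \<inter> A)"
    using insert.IH[of P] by blast
  let ?h = "POr (PAnd (PVar a) f) (PAnd (PNot (PVar a)) g)"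
  have "sat I ?h = P (I \<inter> insert a A)" for I
    using f g by (cases "a \<in> I") auto
  then show ?case
    using f g by (intro exI[of _ ?h]) auto
qed

lemma omega_regular_over_mono:
  assumes "omega_regular_over A \<phi>" "A \<subseteq> B" "finite B"
  shows "omega_regular_over B \<phi>"
proof -
  obtain Q :: "nat set" and I \<Delta> F where *: "finite Q" "I \<subseteq> Q" "\<Delta> \<subseteq> Q \<times> Pow A \<times> Q" "F \<subseteq> Q"
    "\<And>\<sigma>. \<sigma> \<in> \<phi> \<longleftrightarrow> (\<exists>run. run 0 \<in> I \<and> (\<forall>i. (run i, \<sigma> i \<inter> A, run (Suc i)) \<in> \<Delta>) \<and>
              (\<forall>i. \<exists>j\<ge>i. run j \<in> F))"
    using assms(1) unfolding omega_regular_over_def by blast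
  \<comment> \<open>The automaton reads a letter over \<open>B\<close> through its trace on
    \<open>A\<close>, so the additional variables are ignored.\<close>
  define \<Delta>' where "\<Delta>' = {(q, a, q'). a \<subseteq> B \<and> (q, a \<inter> A, q') \<in> \<Delta>}"
  have "(q, S \<inter> B, q') \<in> \<Delta>' \<longleftrightarrow> (q, S \<inter> A, q') \<in> \<Delta>" for q q' S
    using assms(2) by (auto simp: \<Delta>'_def Int_assoc Int_absorb1)
  moreover have "\<Delta>' \<subseteq> Q \<times> Pow B \<times> Q"
    using *(3) unfolding \<Delta>'_def by blast
  ultimately show ?thesis
    unfolding omega_regular_over_def using * assms(3)
    by (intro conjI exI[of _ Q] exI[of _ I] exI[of _ \<Delta>'] exI[of _ F]) simp_all
qed

lemma omega_regular_over_cong: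
  assumes "omega_regular_over A \<phi>" "\<And>i. \<sigma> i \<inter> A = \<tau> i \<inter> A"
  shows "\<sigma> \<in> \<phi> \<longleftrightarrow> \<tau> \<in> \<phi>"
proof -
  obtain I \<Delta> and F :: "nat set" where
    "\<And>\<sigma>. \<sigma> \<in> \<phi> \<longleftrightarrow> (\<exists>run. run 0 \<in> I \<and> (\<forall>i. (run i, \<sigma> i \<inter> A, run (Suc i)) \<in> \<Delta>) \<and>
              (\<forall>i. \<exists>j\<ge>i. run j \<in> F))"
    using assms(1) unfolding omega_regular_over_def by blast
  then show ?thesis
    using assms(2) by simp
qed


section \<open>Consistent histories\<close>

definition consistent_history ::
  "('v, 'z) gs_scheme \<Rightarrow> 'v strategy \<Rightarrow> 'v set \<Rightarrow> 'v set list \<Rightarrow> bool" where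
  "consistent_history G f s h \<longleftrightarrow> history_from G s h \<and> history_consistent G f h"

lemma consistent_history_single:
  "s \<in> states G \<Longrightarrow> consistent_history G f s [s]"
  by (simp add: consistent_history_def history_from_def history_consistent_def)

lemma consistent_history_not_Nil: "consistent_history G f s h \<Longrightarrow> h \<noteq> []"
  by (simp add: consistent_history_def history_from_def)

lemma consistent_history_states: "consistent_history G f s h \<Longrightarrow> set h \<subseteq> states G"
  by (simp add: consistent_history_def history_from_def)

lemma consistent_history_snoc_iff:
  assumes "h \<noteq> []"
  shows "consistent_history G f s (h @ [t]) \<longleftrightarrow>
     consistent_history G f s h \<and> gs_step G (last h) t \<and>
     f h (t \<inter> inputs G) = Some (t \<inter> outputs G)"
proof -
  have all: "(\<forall>i. Suc i < length (h @ [t]) \<longrightarrow> Q i) \<longleftrightarrow>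
      (\<forall>i. Suc i < length h \<longrightarrow> Q i) \<and> Q (length h - 1)" for Q
    using assms by (auto simp: less_Suc_eq dest: sym)
  have "(\<forall>i. Suc i < length (h @ [t]) \<longrightarrow> gs_step G ((h @ [t]) ! i) ((h @ [t]) ! Suc i)) \<longleftrightarrow>
      (\<forall>i. Suc i < length h \<longrightarrow> gs_step G (h ! i) (h ! Suc i)) \<and> gs_step G (last h) t"
    unfolding all using assms by (simp add: nth_append last_conv_nth)
  moreover have "history_consistent G f (h @ [t]) \<longleftrightarrow>
      history_consistent G f h \<and> f h (t \<inter> inputs G) = Some (t \<inter> outputs G)"
    unfolding history_consistent_def all using assms by (simp add: nth_append)
  ultimately show ?thesis
    unfolding consistent_history_def history_from_def using assms
    by (auto simp: gs_step_def)
qed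

lemma consistent_history_induct [consumes 1, case_names single snoc]:
  assumes "consistent_history G f s h"
    and "P [s]"
    and "\<And>h t. consistent_history G f s h \<Longrightarrow> consistent_history G f s (h @ [t]) \<Longrightarrow> P h \<Longrightarrow> P (h @ [t])"
  shows "P h"
  using assms(1)
proof (induction h rule: rev_induct)
  case Nil
  then show ?case by (simp add: consistent_history_def history_from_def)
next
  case (snoc t h)
  show ?case
  proof (cases "h = []")
    case True
    then have "t = s"
      using snoc.prems by (simp add: consistent_history_def history_from_def)
    then show ?thesis
      using True assms(2) by simp
  next
    case False
    then show ?thesis
      using snoc consistent_history_snoc_iff assms(3) by metis
  qed
qed

lemma state_split:
  "t \<in> states G \<Longrightarrow> (t \<inter> inputs G) \<union> (t \<inter> outputs G) = t"
  by (auto simp: states_def outputs_def)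

lemma consistent_history_snoc:
  assumes "inputs G \<subseteq> gvars G" "sys_strategy G f" "consistent_history G f s h"
    and "valid_input G (last h) x" "f h x = Some y"
  shows "consistent_history G f s (h @ [x \<union> y])"
proof -
  have vo: "valid_output G (last h) x y"
    using assms(2,5) by (auto simp: sys_strategy_def)
  have "(x \<union> y) \<inter> inputs G = x" "(x \<union> y) \<inter> outputs G = y" "x \<union> y \<in> states G"
    using vo assms(1,4) by (auto simp: valid_output_def valid_input_def outputs_def states_def)
  then show ?thesis
    using assms vo consistent_history_not_Nil[OF assms(3)]
    by (simp add: consistent_history_snoc_iff gs_step_def)
qed

lemma consistent_history_take:
  assumes "consistent_history G f s h" "0 < n"
  shows "consistent_history G f s (take n h)"
proof -
  have "set (take n h) \<subseteq> set h"
    by (rule set_take_subset)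
  then show ?thesis
    using assms by (auto simp: consistent_history_def history_from_def history_consistent_def min_def)
qed

section \<open>Plays as limits of consistent histories\<close>

lemma infinite_play_consistent_iff:
  assumes "s \<in> states G"
  shows "play_from G s (Infinite \<sigma>) \<and> play_consistent G f (Infinite \<sigma>) \<longleftrightarrow>
     (\<forall>n. consistent_history G f s (map \<sigma> [0..<Suc n]))" (is "?L \<longleftrightarrow> ?R")
proof
  assume L: ?L
  show ?R
  proof
    fix n
    have "\<sigma> i \<in> states G" for i
      using L by (cases i) (auto simp: gs_step_def)
    moreover have "hd (map \<sigma> [0..<Suc n]) = s"
      using L by (simp add: hd_map del: upt_Suc)
    moreover have "map \<sigma> [0..<Suc n] \<in> prefixes (Infinite \<sigma>)"
      by (auto simp del: upt_Suc)
    ultimately show "consistent_history G f s (map \<sigma> [0..<Suc n])"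
      using L unfolding consistent_history_def history_from_def play_consistent_def
      by (auto simp del: upt_Suc prefixes.simps)
  qed
next
  assume R: ?R
  have "\<sigma> 0 = s"
    using R[rule_format, of 0] by (simp add: consistent_history_def history_from_def)
  moreover have "gs_step G (\<sigma> i) (\<sigma> (Suc i))" for i
    using R[rule_format, of "Suc i"] consistent_history_snoc_iff[of "map \<sigma> [0..<Suc i]" G f s "\<sigma> (Suc i)"]
    by simp
  moreover have "history_consistent G f h" if h: "h \<in> prefixes (Infinite \<sigma>)" for h
  proof -
    obtain n where "0 < n" "h = map \<sigma> [0..<n]"
      using h by auto
    then obtain m where "h = map \<sigma> [0..<Suc m]"
      by (metis Suc_pred)
    then show ?thesis
      using R by (simp only: consistent_history_def)
  qed
  ultimately show ?L
    using assms by (simp add: play_consistent_def del: prefixes.simps)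
qed

lemma finite_play_consistent:
  assumes "consistent_history G f s h"
  shows "play_consistent G f (Env_Deadlock h)" "play_consistent G f (Sys_Deadlock h x)"
  using consistent_history_take[OF assms] by (auto simp: play_consistent_def consistent_history_def)

lemma finite_play_consistentD:
  assumes "play_consistent G f (Env_Deadlock h) \<or> play_consistent G f (Sys_Deadlock h x)"
    and "history_from G s h"
  shows "consistent_history G f s h"
proof -
  have "\<exists>n. h = take n h \<and> 0 < n \<and> n \<le> length h"
    using assms(2) by (intro exI[of _ "length h"]) (simp add: history_from_def)
  then have "history_consistent G f h"
    using assms(1) by (auto simp: play_consistent_def)
  then show ?thesis
    using assms(2) by (simp add: consistent_history_def)
qed

text \<open>Energy is tested only on prefixes of plays; to obtain it for all consistent histories,
  each must be a prefix of some consistent play. By \<open>total\<close> it can be prolonged as long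
  as the environment has a valid input: this ends in an environment deadlock or converges to an
  infinite play.\<close>

lemma consistent_history_extends:
  assumes "inputs G \<subseteq> gvars G" "sys_strategy G f" "s \<in> states G"
    and total: "\<And>h x. consistent_history G f s h \<Longrightarrow> valid_input G (last h) x \<Longrightarrow> f h x \<noteq> None"
    and h: "consistent_history G f s h"
  obtains \<pi> where "play_from G s \<pi>" "play_consistent G f \<pi>" "h \<in> prefixes \<pi>"
proof -
  \<comment> \<open>Without a valid input \<open>x\<close> is arbitrary; no consistency is claimed
    for the chain beyond that point.\<close>
  define nxt where "nxt h = (let x = SOME x. valid_input G (last h) x in h @ [x \<union> the (f h x)])" for h
  define chain where "chain n = (nxt ^^ n) h" for n
  have chain_Suc: "chain (Suc n) = nxt (chain n)" for n
    by (simp add: chain_def)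
  have len: "length (chain n) = length h + n" for n
    by (induction n) (simp_all add: chain_def nxt_def Let_def)
  have pre: "take (length (chain m)) (chain (m + k)) = chain m" for m k
    by (induction k) (simp_all add: chain_Suc nxt_def Let_def len)
  have step: "consistent_history G f s (chain (Suc n))"
    if ch: "consistent_history G f s (chain n)" and vi: "valid_input G (last (chain n)) x" for n x
  proof -
    have *: "valid_input G (last (chain n)) (SOME x. valid_input G (last (chain n)) x)"
      using vi by (rule someI)
    then obtain y where "f (chain n) (SOME x. valid_input G (last (chain n)) x) = Some y"
      using total ch by blast
    then show ?thesis
      using consistent_history_snoc[OF assms(1,2) ch *] by (simp add: chain_Suc nxt_def)
  qed
  show thesis
  proof (cases "\<exists>n. consistent_history G f s (chain n) \<and> (\<forall>x. \<not> valid_input G (last (chain n)) x)")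
    case True
    then obtain n where n: "consistent_history G f s (chain n)"
      "\<And>x. \<not> valid_input G (last (chain n)) x"
      by blast
    have "h = take (length h) (chain n)" "0 < length h" "length h \<le> length (chain n)"
      using pre[of 0 n] consistent_history_not_Nil[OF h] len[of n] by (simp_all add: chain_def)
    then have "h \<in> prefixes (Env_Deadlock (chain n))"
      by auto
    then show ?thesis
      using that[of "Env_Deadlock (chain n)"] n finite_play_consistent(1)[OF n(1)]
      by (simp add: consistent_history_def)
  next
    case False
    have ch: "consistent_history G f s (chain n)" for n
      by (induction n) (use h step False in \<open>auto simp: chain_def\<close>)
    \<comment> \<open>Diagonal limit: \<open>chain i\<close> has more than \<open>i\<close> entries
      because \<open>h\<close> is nonempty, and later stages keep them by
      \<open>pre\<close>.\<close>
    define \<sigma> where "\<sigma> i = chain i ! i" for i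
    have \<sigma>: "map \<sigma> [0..<n] = take n (chain n)" for n
    proof (rule nth_equalityI)
      fix i
      assume i: "i < length (map \<sigma> [0..<n])"
      have "chain i ! i = take (length (chain i)) (chain (i + (n - i))) ! i"
        by (simp add: pre)
      also have "\<dots> = chain n ! i"
        using i len[of i] consistent_history_not_Nil[OF h] by simp
      finally show "map \<sigma> [0..<n] ! i = take n (chain n) ! i"
        using i by (simp add: \<sigma>_def)
    qed (simp add: len)
    have "consistent_history G f s (map \<sigma> [0..<Suc n])" for n
      unfolding \<sigma> using consistent_history_take[OF ch] by simp
    moreover have "h = map \<sigma> [0..<length h]"
      using pre[of 0 "length h"] by (simp add: \<sigma> chain_def)
    then have "h \<in> prefixes (Infinite \<sigma>)"
      using consistent_history_not_Nil[OF h] by auto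
    ultimately show ?thesis
      using that infinite_play_consistent_iff[OF assms(3)] by blast
  qed
qed

text \<open>Avoiding a system deadlock amounts to answering every valid input, because a strategy
  from \<open>s\<close> is undefined only where no output is valid. \<open>P\<close> is
  \<open>True\<close> for the qualitative game and nonnegative energy for the weighted one, so both
  objectives get the same form.\<close>

lemma all_plays_win_iff:
  assumes "inputs G \<subseteq> gvars G" "sys_strategy_from G s f" "s \<in> states G"
  shows "(\<forall>\<pi>. play_from G s \<pi> \<and> play_consistent G f \<pi> \<longrightarrow>
            play_wins G \<pi> \<and> (\<forall>h\<in>prefixes \<pi>. P h)) \<longleftrightarrow>
     (\<forall>h. consistent_history G f s h \<longrightarrow>
        P h \<and> (\<forall>x. valid_input G (last h) x \<longrightarrow> f h x \<noteq> None)) \<and>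
     (\<forall>\<sigma>. (\<forall>n. consistent_history G f s (map \<sigma> [0..<Suc n])) \<longrightarrow> \<sigma> \<in> wincond G)"
    (is "?L \<longleftrightarrow> ?R1 \<and> ?R2")
proof
  assume L: ?L
  have total: "f h x \<noteq> None" if "consistent_history G f s h" "valid_input G (last h) x" for h x
  proof (rule ccontr)
    assume "\<not> f h x \<noteq> None"
    then have "\<forall>y. \<not> valid_output G (last h) x y"
      using assms(2) that unfolding sys_strategy_from_def consistent_history_def by blast
    then have "play_from G s (Sys_Deadlock h x)"
      using that by (simp add: consistent_history_def)
    then show False
      using L finite_play_consistent(2)[OF that(1)] by fastforce
  qed
  have "P h" if h: "consistent_history G f s h" for h
    using consistent_history_extends[OF assms(1) _ assms(3) total h] assms(2) L
    unfolding sys_strategy_from_def by metis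
  moreover have ?R2
    using L infinite_play_consistent_iff[OF assms(3), of _ f]
    by (metis play_wins.simps(1))
  ultimately show "?R1 \<and> ?R2"
    using total by blast
next
  assume R: "?R1 \<and> ?R2"
  show ?L
  proof (intro allI impI)
    fix \<pi>
    assume \<pi>: "play_from G s \<pi> \<and> play_consistent G f \<pi>"
    show "play_wins G \<pi> \<and> (\<forall>h\<in>prefixes \<pi>. P h)"
    proof (cases \<pi>)
      case (Infinite \<sigma>)
      then have ch: "consistent_history G f s (map \<sigma> [0..<Suc n])" for n
        using \<pi> infinite_play_consistent_iff[OF assms(3)] by blast
      have "P (map \<sigma> [0..<n])" if "0 < n" for n
        using R ch[of "n - 1"] that by simp
      then show ?thesis
        using R ch Infinite by (auto simp del: upt_Suc)
    next
      case (Env_Deadlock h)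
      then have "consistent_history G f s h"
        using \<pi> finite_play_consistentD by fastforce
      then have "P (take n h)" if "0 < n" for n
        using R consistent_history_take that by blast
      then show ?thesis
        using Env_Deadlock by auto
    next
      case (Sys_Deadlock h x)
      then have "consistent_history G f s h" "valid_input G (last h) x"
        using \<pi> finite_play_consistentD by fastforce+
      then obtain y where "f h x = Some y"
        using R by blast
      then have "valid_output G (last h) x y"
        using assms(2) by (auto simp: sys_strategy_from_def sys_strategy_def)
      then show ?thesis
        using \<pi> Sys_Deadlock by auto
    qed
  qed
qed

text \<open>A simulation: while playing \<open>B\<close>, the system keeps a shadow history in
  \<open>A\<close> on which it consults \<open>f\<close>; \<open>R\<close> is the invariant. It
  relates whole histories because energy and strategies depend on the past. Every consistent history
  of \<open>B\<close> is shadowed, also in the limit, which carries over energy bounds and winning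
  conditions. It serves both directions between \<open>G\<close> and its expansion.\<close>

lemma strategy_transfer:
  fixes A :: "('v, 'y) gs_scheme" and B :: "('v, 'z) gs_scheme"
  assumes strat: "sys_strategy A f"
    and total: "\<And>h x. consistent_history A f a h \<Longrightarrow> valid_input A (last h) x \<Longrightarrow> f h x \<noteq> None"
    and inp: "inputs A = inputs B" "inputs A \<subseteq> gvars A" "inputs B \<subseteq> gvars B"
    and init: "a \<in> states A" "b \<in> states B" "R [a] [b]"
    and R_input: "\<And>h k x. consistent_history A f a h \<Longrightarrow> history_from B b k \<Longrightarrow> R h k \<Longrightarrow>
       valid_input B (last k) x \<Longrightarrow> valid_input A (last h) x"
    and R_output: "\<And>h k x y. consistent_history A f a h \<Longrightarrow> history_from B b k \<Longrightarrow> R h k \<Longrightarrow>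
       valid_input B (last k) x \<Longrightarrow> f h x = Some y \<Longrightarrow>
       \<exists>z. valid_output B (last k) x z \<and> R (h @ [x \<union> y]) (k @ [x \<union> z])"
  obtains g where "sys_strategy_from B b g"
    and "\<And>k x. consistent_history B g b k \<Longrightarrow> valid_input B (last k) x \<Longrightarrow> g k x \<noteq> None"
    and "\<And>k. consistent_history B g b k \<Longrightarrow> \<exists>h. consistent_history A f a h \<and> R h k"
    and "\<And>\<sigma>. (\<And>n. consistent_history B g b (map \<sigma> [0..<Suc n])) \<Longrightarrow>
       \<exists>\<tau>. \<forall>n. consistent_history A f a (map \<tau> [0..<Suc n]) \<and>
         R (map \<tau> [0..<Suc n]) (map \<sigma> [0..<Suc n])"
proof -
  \<comment> \<open>The shadow of \<open>k\<close> depends only on the inputs in \<open>k\<close>,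
    since \<open>f\<close> supplies the outputs; so \<open>g\<close> can recompute it from
    \<open>k\<close>. On consistent histories \<open>the\<close> meets only defined values, as
    \<open>main\<close> shows.\<close>
  define L where "L k = foldl (\<lambda>h t. h @ [(t \<inter> inputs A) \<union> the (f h (t \<inter> inputs A))]) [a] (tl k)" for k
  have L_single: "L [t] = [a]" for t
    by (simp add: L_def)
  have L_snoc: "L (k @ [t]) = L k @ [(t \<inter> inputs A) \<union> the (f (L k) (t \<inter> inputs A))]" if "k \<noteq> []" for k t
    using that by (simp add: L_def)
  \<comment> \<open>An answer must be valid in \<open>B\<close> and also preserve \<open>R\<close>
    after one more step of the shadow.\<close>
  define Q where "Q k x z \<longleftrightarrow> valid_output B (last k) x z \<and>
      R (L k @ [x \<union> the (f (L k) x)]) (k @ [x \<union> z])" for k x z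
  define g where "g k x =
     (if k \<noteq> [] \<and> set k \<subseteq> states B \<and> x \<subseteq> inputs B \<and> (\<exists>z. Q k x z) then Some (SOME z. Q k x z) else None)" for k x
  have gD: "k \<noteq> [] \<and> set k \<subseteq> states B \<and> x \<subseteq> inputs B \<and> Q k x z" if "g k x = Some z" for k x z
    using that unfolding g_def by (auto split: if_splits intro: someI)
  have strat_g: "sys_strategy B g"
    unfolding sys_strategy_def using gD unfolding Q_def by blast
  have main: "consistent_history A f a (L k) \<and> R (L k) k" if "consistent_history B g b k" for k
    using that
  proof (induction rule: consistent_history_induct)
    case single
    then show ?case
      using init by (simp add: L_single consistent_history_single)
  next
    case (snoc k t)
    let ?x = "t \<inter> inputs A"
    have ne: "k \<noteq> []"
      using snoc.hyps(1) by (rule consistent_history_not_Nil)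
    have st: "gs_step B (last k) t" "g k ?x = Some (t \<inter> outputs B)"
      using snoc.hyps(2) inp(1) by (simp_all add: consistent_history_snoc_iff[OF ne])
    have vi: "valid_input B (last k) ?x"
      using st(1) inp(1) by (simp add: gs_step_def)
    then have viA: "valid_input A (last (L k)) ?x"
      using R_input snoc by (meson consistent_history_def)
    then obtain y where y: "f (L k) ?x = Some y"
      using total snoc.IH by (meson not_None_eq)
    have "consistent_history A f a (L (k @ [t]))"
      using consistent_history_snoc[OF inp(2) strat _ viA y] snoc.IH y by (simp add: L_snoc[OF ne])
    moreover have "R (L (k @ [t])) (k @ [t])"
      using gD[OF st(2)] state_split[of t B] st(1) inp(1)
      by (simp add: Q_def L_snoc[OF ne] gs_step_def)
    ultimately show ?case
      by blast
  qed
  have total_g: "g k x \<noteq> None" if k: "consistent_history B g b k" "valid_input B (last k) x" for k x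
  proof -
    have hf: "history_from B b k"
      using k(1) by (simp add: consistent_history_def)
    obtain y where y: "f (L k) x = Some y"
      using total main[OF k(1)] R_input[OF _ hf _ k(2)] by (meson not_None_eq)
    then obtain z where "Q k x z"
      using R_output[OF _ hf _ k(2) y] main[OF k(1)] by (auto simp: Q_def)
    then show ?thesis
      using k consistent_history_not_Nil[OF k(1)] consistent_history_states[OF k(1)]
      by (auto simp: g_def valid_input_def)
  qed
  show thesis
  proof (rule that)
    show "sys_strategy_from B b g"
      using strat_g total_g unfolding sys_strategy_from_def consistent_history_def by blast
    show "\<exists>\<tau>. \<forall>n. consistent_history A f a (map \<tau> [0..<Suc n]) \<and>
         R (map \<tau> [0..<Suc n]) (map \<sigma> [0..<Suc n])"
      if "\<And>n. consistent_history B g b (map \<sigma> [0..<Suc n])" for \<sigma>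
    proof -
      \<comment> \<open>Each round appends one state to the shadow, so the last states form a
        sequence whose prefixes are the shadows.\<close>
      define \<tau> where "\<tau> i = last (L (map \<sigma> [0..<Suc i]))" for i
      have "map \<tau> [0..<Suc n] = L (map \<sigma> [0..<Suc n])" for n
      proof (induction n)
        case 0
        then show ?case by (simp add: \<tau>_def L_single)
      next
        case (Suc n)
        have "map \<tau> [0..<Suc (Suc n)] = map \<tau> [0..<Suc n] @ [\<tau> (Suc n)]"
          by simp
        also have "\<dots> = L (map \<sigma> [0..<Suc n] @ [\<sigma> (Suc n)])"
          unfolding Suc.IH by (subst L_snoc) (simp_all add: \<tau>_def L_snoc[of "map \<sigma> [0..<n] @ [\<sigma> n]", simplified])
        finally show ?case by simp
      qed
      then show ?thesis
        using main that by metis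
    qed
  qed (use total_g main in blast)+
qed


section \<open>Fixed points in a finite powerset\<close>

lemma finite_subset_UN_incseq:
  assumes "finite S" "mono A" "S \<subseteq> (\<Union>i::nat. A i)"
  shows "\<exists>k. S \<subseteq> A k"
  using assms(1,3)
proof (induction S rule: finite_induct)
  case (insert x S)
  then obtain k l where "S \<subseteq> A k" "x \<in> A l"
    by auto
  moreover have "A k \<subseteq> A (max k l)" "A l \<subseteq> A (max k l)"
    using assms(2) by (simp_all add: monoD)
  ultimately show ?case
    by (intro exI[of _ "max k l"]) blast
qed simp

text \<open>Bridges two definitions: \<open>mu_sem\<close> intersects pre-fixed points,
  \<open>emu_sem\<close> iterates. Finiteness of \<open>T\<close> replaces continuity: the
  increasing iterates reach their union at some stage, which makes the union a pre-fixed
  point.\<close>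

lemma least_prefixpoint_eq_UN:
  assumes "finite T" "mono F" "\<And>i. (F ^^ i) {} \<subseteq> T"
  shows "\<Inter> {S. S \<subseteq> T \<and> F S \<subseteq> S} = (\<Union>i. (F ^^ i) {})" (is "_ = ?U")
proof
  have le: "(F ^^ i) {} \<subseteq> S" if "F S \<subseteq> S" for S i
  proof (induction i)
    case (Suc i)
    then show ?case using that monoD[OF assms(2) Suc] by simp
  qed simp
  then show "?U \<subseteq> \<Inter> {S. S \<subseteq> T \<and> F S \<subseteq> S}"
    by blast
  have "(F ^^ i) {} \<subseteq> (F ^^ Suc i) {}" for i
    by (induction i) (use monoD[OF assms(2)] in auto)
  then have "mono (\<lambda>i. (F ^^ i) {})"
    by (rule mono_iff_le_Suc[THEN iffD2, rule_format])
  moreover have "?U \<subseteq> T"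
    using assms(3) by blast
  ultimately obtain k where "?U \<subseteq> (F ^^ k) {}"
    using finite_subset_UN_incseq[of ?U "\<lambda>i. (F ^^ i) {}"] assms(1) finite_subset by blast
  then have "F ?U \<subseteq> (F ^^ Suc k) {}"
    using monoD[OF assms(2)] by simp
  then have "F ?U \<subseteq> ?U"
    by blast
  then show "\<Inter> {S. S \<subseteq> T \<and> F S \<subseteq> S} \<subseteq> ?U"
    using \<open>?U \<subseteq> T\<close> by (intro Inter_lower) simp
qed

lemma greatest_postfixpoint_eq_INT:
  assumes "finite T" "mono F" "F T \<subseteq> T"
  shows "\<Union> {S. S \<subseteq> T \<and> S \<subseteq> F S} = (\<Inter>i. (F ^^ i) T)" (is "_ = ?I")
proof
  have ge: "S \<subseteq> (F ^^ i) T" if "S \<subseteq> T" "S \<subseteq> F S" for S i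
  proof (induction i)
    case (Suc i)
    then show ?case using that(2) monoD[OF assms(2) Suc] by simp
  qed (use that in simp)
  then show "\<Union> {S. S \<subseteq> T \<and> S \<subseteq> F S} \<subseteq> ?I"
    by blast
  have dec: "(F ^^ Suc i) T \<subseteq> (F ^^ i) T" for i
    by (induction i) (use assms(3) monoD[OF assms(2)] in auto)
  \<comment> \<open>Complements in \<open>T\<close> turn the decreasing iterates into an increasing
    chain, to which \<open>finite_subset_UN_incseq\<close> applies.\<close>
  then have "mono (\<lambda>i. T - (F ^^ i) T)"
    by (intro mono_iff_le_Suc[THEN iffD2] allI) blast
  moreover have "T - ?I \<subseteq> (\<Union>i. T - (F ^^ i) T)"
    by blast
  ultimately obtain k where "T - ?I \<subseteq> T - (F ^^ k) T"
    using finite_subset_UN_incseq[of "T - ?I" "\<lambda>i. T - (F ^^ i) T"] assms(1) by blast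
  moreover have le_T: "(F ^^ i) T \<subseteq> T" for i
    by (induction i) (use dec in auto)
  ultimately have "(F ^^ k) T \<subseteq> ?I"
    by blast
  then have "(F ^^ Suc k) T \<subseteq> F ?I"
    using monoD[OF assms(2)] by simp
  then have "?I \<subseteq> F ?I"
    by blast
  moreover have "?I \<subseteq> T"
    using le_T by blast
  ultimately show "?I \<subseteq> \<Union> {S. S \<subseteq> T \<and> S \<subseteq> F S}"
    by (intro Union_upper) simp
qed

lemma mu_sem_mono: "(\<And>X. E X \<subseteq> E' X) \<Longrightarrow> mu_sem G a E \<subseteq> mu_sem G a E'"
proof (induction a arbitrary: E E')
  case (MOr a b)
  show ?case using Un_mono[OF MOr.IH, OF MOr.prems MOr.prems] by simp
next
  case (MAnd a b)
  show ?case using Int_mono[OF MAnd.IH, OF MAnd.prems MAnd.prems] by simp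
next
  case (MDia a)
  then show ?case by simp blast
next
  case (MBox a)
  then show ?case by simp blast
next
  case (Mu X a)
  have "mu_sem G a (E(X := S)) \<subseteq> mu_sem G a (E'(X := S))" for S
    by (rule Mu.IH) (simp add: Mu.prems)
  from subset_trans[OF this] show ?case
    unfolding mu_sem.simps by (intro Inter_anti_mono Collect_mono) blast
next
  case (Nu X a)
  have "mu_sem G a (E(X := S)) \<subseteq> mu_sem G a (E'(X := S))" for S
    by (rule Nu.IH) (simp add: Nu.prems)
  from subset_trans[OF _ this] show ?case
    unfolding mu_sem.simps by (intro Union_mono Collect_mono) blast
qed auto


section \<open>The expanded game structure\<close>

lemma energy_level_single [simp]: "energy_level G c e [t] = int e"
  by (simp add: energy_level_def)

lemma energy_level_snoc:
  assumes "h \<noteq> []"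
  shows "energy_level G c e (h @ [t]) =
    cap c (energy_level G c e h + the (weight G (step (last h) t)))"
proof -
  have eq: "energy_at G c e (h @ [t]) i = energy_at G c e h i" if "i < length h" for i
    using that by (induction i) (simp_all add: nth_append)
  obtain n where n: "length h = Suc n"
    using assms by (cases h) auto
  then have "last h = h ! n" "(h @ [t]) ! n = h ! n" "(h @ [t]) ! Suc n = t"
    using assms by (simp_all add: last_conv_nth nth_append)
  then show ?thesis
    using n eq[of n] by (simp add: energy_level_def)
qed

text \<open>For \<open>e \<le> c\<close> both truncations in \<open>EC\<close> are invisible: a
  difference above \<open>c\<close> exceeds \<open>e\<close> anyway, and cutting at 0 does not
  affect a comparison with a natural number. What remains has the shape of the level constraint in
  \<open>expanded_rho\<close>.\<close>

lemma EC_le_iff: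
  "EC G c st a \<le> enat e \<longleftrightarrow> \<not> sat st (rho_e G) \<or>
     sat st (rho_s G) \<and> (\<exists>n. a = enat n \<and> int n \<le> int e + the (weight G st))"
  if "e \<le> c"
  using that by (cases a) (auto simp: EC_def Let_def)

lemma EC_range: "EC G c st a \<le> enat c \<or> EC G c st a = \<infinity>"
  by (cases a) (auto simp: EC_def Let_def)

locale energy_expansion =
  fixes G :: "'v wgs" and c :: nat and Z :: "'v set"
  assumes wgs: "weighted_game_structure G"
    and fin_Z: "finite Z" and disj: "gvars G \<inter> Z = {}" and card_Z: "card Z = c"
begin

abbreviation "V \<equiv> gvars G"

text \<open>Unary rather than binary counting: with \<open>card Z = c\<close> exactly the values
  from 0 to \<open>c\<close> occur, whatever \<open>c\<close> is.\<close>

definition level :: "'v set \<Rightarrow> nat" where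
  "level u = card (u \<inter> Z)"

text \<open>The constraint is given semantically, so a formula for it is chosen by
  \<open>SOME\<close>. The cap is absent because \<open>level t\<close> never exceeds
  \<open>c\<close>; a transition with a negative right-hand side is impossible.\<close>

definition expanded_rho :: "'v pvar pform" where
  "expanded_rho = (SOME f. patoms f \<subseteq> Unprimed ` (V \<union> Z) \<union> Primed ` (V \<union> Z) \<and>
     (\<forall>u\<subseteq>V \<union> Z. \<forall>t\<subseteq>V \<union> Z. sat (step u t) f \<longleftrightarrow>
        sat (step (u \<inter> V) (t \<inter> V)) (rho_s G) \<and>
        int (level t) \<le> int (level u) + the (weight G (step (u \<inter> V) (t \<inter> V)))))"

definition expanded :: "'v gs" where
  "expanded = \<lparr>gvars = V \<union> Z, inputs = inputs G, rho_e = rho_e G, rho_s = expanded_rho,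
     wincond = wincond G\<rparr>"

lemma expanded_simps [simp]:
  "gvars expanded = V \<union> Z" "inputs expanded = inputs G" "rho_e expanded = rho_e G"
  "rho_s expanded = expanded_rho" "wincond expanded = wincond G"
  by (simp_all add: expanded_def)

lemma gs: "game_structure G"
  using wgs by (simp add: weighted_game_structure_def)

lemma inputs_subset: "inputs G \<subseteq> V" and finite_V: "finite V"
  using gs by (simp_all add: game_structure_def)

lemma expanded_rho:
  "patoms expanded_rho \<subseteq> Unprimed ` (V \<union> Z) \<union> Primed ` (V \<union> Z)"
  "u \<subseteq> V \<union> Z \<Longrightarrow> t \<subseteq> V \<union> Z \<Longrightarrow> sat (step u t) expanded_rho \<longleftrightarrow>
     sat (step (u \<inter> V) (t \<inter> V)) (rho_s G) \<and>
     int (level t) \<le> int (level u) + the (weight G (step (u \<inter> V) (t \<inter> V)))"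
proof -
  let ?A = "Unprimed ` (V \<union> Z) \<union> Primed ` (V \<union> Z)"
  let ?C = "\<lambda>u t. sat (step (u \<inter> V) (t \<inter> V)) (rho_s G) \<and>
     int (level t) \<le> int (level u) + the (weight G (step (u \<inter> V) (t \<inter> V)))"
  have "finite ?A"
    using finite_V fin_Z by simp
  from ex_pform[OF this, of "\<lambda>I. ?C {v. Unprimed v \<in> I} {v. Primed v \<in> I}"] obtain f where
    f: "patoms f \<subseteq> ?A"
       "\<And>I. sat I f = ?C {v. Unprimed v \<in> I \<inter> ?A} {v. Primed v \<in> I \<inter> ?A}"
    by blast
  have "sat (step u t) f \<longleftrightarrow> ?C u t" if "u \<subseteq> V \<union> Z" "t \<subseteq> V \<union> Z" for u t
  proof -
    have "{v. Unprimed v \<in> step u t \<inter> ?A} = u" "{v. Primed v \<in> step u t \<inter> ?A} = t"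
      using that by (auto simp: step_def)
    then show ?thesis
      by (simp only: f(2))
  qed
  then have "\<exists>f. patoms f \<subseteq> ?A \<and> (\<forall>u\<subseteq>V \<union> Z. \<forall>t\<subseteq>V \<union> Z. sat (step u t) f \<longleftrightarrow> ?C u t)"
    using f(1) by blast
  from someI_ex[OF this] show "patoms expanded_rho \<subseteq> ?A"
    "u \<subseteq> V \<union> Z \<Longrightarrow> t \<subseteq> V \<union> Z \<Longrightarrow> sat (step u t) expanded_rho \<longleftrightarrow> ?C u t"
    unfolding expanded_rho_def by blast+
qed

lemma game_structure_expanded: "game_structure expanded"
  using gs fin_Z expanded_rho(1) omega_regular_over_mono[of V "wincond G" "V \<union> Z"]
  unfolding game_structure_def by auto

lemma level_le: "level u \<le> c"
  using card_mono[OF fin_Z, of "u \<inter> Z"] by (simp add: level_def card_Z)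

lemma ex_level:
  assumes "k \<le> c"
  shows "\<exists>Y\<subseteq>Z. \<forall>s\<subseteq>V. level (s \<union> Y) = k"
proof -
  obtain Y where Y: "Y \<subseteq> Z" "card Y = k"
    using obtain_subset_with_card_n[of k Z] assms card_Z by blast
  then have "(s \<union> Y) \<inter> Z = Y" if "s \<subseteq> V" for s
    using that disj by blast
  then show ?thesis
    using Y by (intro exI[of _ Y]) (simp add: level_def)
qed

lemma states_expanded: "u \<in> states expanded \<longleftrightarrow> u \<subseteq> V \<union> Z"
  by (simp add: states_def)

text \<open>\<open>rho_e\<close> reads only the inputs of the successor. Hence \<open>EC\<close>,
  which evaluates it on the full successor, agrees with \<open>valid_input\<close>, which evaluates
  it on the input alone.\<close>

lemma sat_rho_e:
  assumes "u \<inter> V = s \<inter> V" "t \<inter> inputs G = x \<inter> inputs G"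
  shows "sat (step u t) (rho_e G) \<longleftrightarrow> sat (step s x) (rho_e G)"
proof (rule sat_cong)
  fix a
  assume "a \<in> patoms (rho_e G)"
  then have "a \<in> Unprimed ` V \<union> Primed ` inputs G"
    using gs by (auto simp: game_structure_def)
  then show "a \<in> step u t \<longleftrightarrow> a \<in> step s x"
    using assms by (auto simp: step_def)
qed

lemma valid_input_expanded: "valid_input expanded u x \<longleftrightarrow> valid_input G (u \<inter> V) x"
  using sat_rho_e[of u "u \<inter> V" x x] by (simp add: valid_input_def)

lemma valid_output_expanded:
  assumes "u \<subseteq> V \<union> Z" "x \<subseteq> inputs G"
  shows "valid_output expanded u x y \<longleftrightarrow> y \<subseteq> outputs G \<union> Z \<and>
     valid_output G (u \<inter> V) x (y \<inter> V) \<and>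
     int (level (x \<union> y)) \<le> int (level u) + the (weight G (step (u \<inter> V) (x \<union> (y \<inter> V))))"
proof -
  have "outputs expanded = outputs G \<union> Z"
    using disj inputs_subset by (auto simp: outputs_def)
  moreover have "(x \<union> y) \<inter> V = x \<union> (y \<inter> V)"
    using assms inputs_subset by blast
  moreover have "x \<union> y \<subseteq> V \<union> Z" "y \<inter> V \<subseteq> outputs G" if "y \<subseteq> outputs G \<union> Z"
    using that assms inputs_subset disj by (auto simp: outputs_def)
  ultimately show ?thesis
    using expanded_rho(2)[OF assms(1), of "x \<union> y"] by (auto simp: valid_output_def)
qed


section \<open>Semantics of formulas in the expanded game structure\<close>

text \<open>The order is reversed: smaller energy functions give larger sets. A state of value
  \<open>\<infinity>\<close> contributes nothing, since levels are finite.\<close>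

definition upper :: "('v set \<Rightarrow> enat) \<Rightarrow> 'v set set" where
  "upper g = {u \<in> states expanded. g (u \<inter> V) \<le> enat (level u)}"

text \<open>Guarantees that a finite value can be realized as a level.\<close>

definition credit_valued :: "('v set \<Rightarrow> enat) \<Rightarrow> bool" where
  "credit_valued g \<longleftrightarrow> (\<forall>s\<in>states G. g s \<le> enat c \<or> g s = \<infinity>)"

lemma ECpre_le_iff:
  "ECpre G c g s \<le> e \<longleftrightarrow>
     (\<forall>x\<subseteq>inputs G. \<exists>y\<subseteq>outputs G. EC G c (step s (x \<union> y)) (g (x \<union> y)) \<le> e)"
proof -
  have fin: "finite (Pow (inputs G))" "finite (Pow (outputs G))"
    using finite_V inputs_subset finite_subset by (auto simp: outputs_def)
  have "Pow (inputs G) \<noteq> {}" "Pow (outputs G) \<noteq> {}"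
    by blast+
  with fin show ?thesis
    unfolding ECpre_def by (simp add: Min_le_iff) (simp add: Ball_def Bex_def)
qed

lemma credit_valued_ECpre: "credit_valued (ECpre G c g)"
proof -
  have "ECpre G c g s \<le> enat c" if fin: "ECpre G c g s \<noteq> \<infinity>" for s
    unfolding ECpre_le_iff
  proof (intro allI impI)
    obtain e where "ECpre G c g s = enat e"
      using fin by auto
    then have "ECpre G c g s \<le> enat e"
      by simp
    then have e: "\<exists>y\<subseteq>outputs G. EC G c (step s (x \<union> y)) (g (x \<union> y)) \<le> enat e" if "x \<subseteq> inputs G" for x
      using that unfolding ECpre_le_iff by blast
    fix x
    assume "x \<subseteq> inputs G"
    then obtain y where "y \<subseteq> outputs G" "EC G c (step s (x \<union> y)) (g (x \<union> y)) \<le> enat e"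
      using e by blast
    moreover from this have "EC G c (step s (x \<union> y)) (g (x \<union> y)) \<le> enat c"
      using EC_range[of G c "step s (x \<union> y)" "g (x \<union> y)"] by auto
    ultimately show "\<exists>y\<subseteq>outputs G. EC G c (step s (x \<union> y)) (g (x \<union> y)) \<le> enat c"
      by blast
  qed
  then show ?thesis
    by (auto simp: credit_valued_def)
qed

text \<open>A successor can be entered at any level up to \<open>c\<close> that does not exceed the
  current level plus the weight, and belongs to \<open>upper g\<close> from level \<open>g\<close>
  on. Such a level exists iff \<open>g\<close> is at most that sum, which is what comparing
  \<open>EC\<close> with the current level expresses.\<close>

lemma upper_ECpre:
  assumes "credit_valued g"
  shows "upper (ECpre G c g) = {u \<in> states expanded. \<forall>x. valid_input expanded u x \<longrightarrow>
     (\<exists>y. valid_output expanded u x y \<and> x \<union> y \<in> upper g)}"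
proof -
  have step_iff: "(\<exists>y. valid_output expanded u x y \<and> x \<union> y \<in> upper g) \<longleftrightarrow>
      (\<exists>y\<subseteq>outputs G. EC G c (step (u \<inter> V) (x \<union> y)) (g (x \<union> y)) \<le> enat (level u))" (is "?L \<longleftrightarrow> ?R")
    if u: "u \<subseteq> V \<union> Z" and x: "valid_input expanded u x" for u x
  proof -
    have xi: "x \<subseteq> inputs G" and sat_e: "sat (step (u \<inter> V) x) (rho_e G)"
      using x unfolding valid_input_expanded by (auto simp: valid_input_def)
    have sat_e': "sat (step (u \<inter> V) (x \<union> y)) (rho_e G)" if "y \<subseteq> outputs G" for y
      using sat_e sat_rho_e[of "u \<inter> V" "u \<inter> V" "x \<union> y" x] that by (auto simp: outputs_def)
    show ?thesis
    proof
      assume ?L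
      then obtain y where y: "valid_output expanded u x y" "x \<union> y \<in> upper g"
        by blast
      have eq: "(x \<union> y) \<inter> V = x \<union> (y \<inter> V)"
        using xi inputs_subset by blast
      obtain n where n: "g (x \<union> (y \<inter> V)) = enat n" "n \<le> level (x \<union> y)"
        using y(2) by (cases "g (x \<union> (y \<inter> V))") (auto simp: upper_def eq)
      have "valid_output G (u \<inter> V) x (y \<inter> V)"
        "int (level (x \<union> y)) \<le> int (level u) + the (weight G (step (u \<inter> V) (x \<union> (y \<inter> V))))"
        using y(1) unfolding valid_output_expanded[OF u xi] by blast+
      then have "y \<inter> V \<subseteq> outputs G" "sat (step (u \<inter> V) (x \<union> (y \<inter> V))) (rho_s G)"
        "int n \<le> int (level u) + the (weight G (step (u \<inter> V) (x \<union> (y \<inter> V))))"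
        using n(2) by (simp_all add: valid_output_def)
      then show ?R
        by (intro exI[of _ "y \<inter> V"]) (simp add: EC_le_iff[OF level_le] n(1))
    next
      assume ?R
      then obtain y n where y: "y \<subseteq> outputs G" "sat (step (u \<inter> V) (x \<union> y)) (rho_s G)"
        "g (x \<union> y) = enat n" "int n \<le> int (level u) + the (weight G (step (u \<inter> V) (x \<union> y)))"
        using sat_e' unfolding EC_le_iff[OF level_le] by blast
      have xy: "x \<union> y \<subseteq> V"
        using xi y(1) inputs_subset by (auto simp: outputs_def)
      then have "n \<le> c"
        using assms[unfolded credit_valued_def, rule_format, of "x \<union> y"] y(3) by (simp add: states_def)
      \<comment> \<open>The least level that \<open>upper g\<close> admits; all surplus energy is
        discarded.\<close>
      then obtain Y where Y: "Y \<subseteq> Z" "level (x \<union> y \<union> Y) = n"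
        using ex_level xy by blast
      have eq: "(y \<union> Y) \<inter> V = y" "(x \<union> (y \<union> Y)) \<inter> V = x \<union> y"
        using xy Y(1) disj by blast+
      have lev: "level (x \<union> (y \<union> Y)) = n"
        using Y(2) by (simp add: Un_assoc)
      have "valid_output expanded u x (y \<union> Y)"
        unfolding valid_output_expanded[OF u xi] eq lev using y Y(1) by (auto simp: valid_output_def)
      moreover have "x \<union> (y \<union> Y) \<in> upper g"
        using xy Y(1) y(3) by (auto simp: upper_def eq lev states_expanded)
      ultimately show ?L
        by blast
    qed
  qed
  \<comment> \<open>On an invalid input \<open>EC\<close> is 0, so the maximum in
    \<open>ECpre\<close> constrains valid inputs only. The output \<open>{}\<close> makes the
    successor equal to \<open>x\<close>.\<close>
  have dead: "\<exists>y\<subseteq>outputs G. EC G c (step (u \<inter> V) (x \<union> y)) (g (x \<union> y)) \<le> enat (level u)"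
    if "x \<subseteq> inputs G" "\<not> valid_input expanded u x" for u x
    using that unfolding valid_input_expanded EC_le_iff[OF level_le]
    by (intro exI[of _ "{}"]) (simp add: valid_input_def)
  have "ECpre G c g (u \<inter> V) \<le> enat (level u) \<longleftrightarrow>
      (\<forall>x. valid_input expanded u x \<longrightarrow> (\<exists>y. valid_output expanded u x y \<and> x \<union> y \<in> upper g))"
    if u: "u \<subseteq> V \<union> Z" for u
  proof -
    have "x \<subseteq> inputs G" if "valid_input expanded u x" for x
      using that by (simp add: valid_input_def)
    then have "(\<forall>x\<subseteq>inputs G. \<exists>y\<subseteq>outputs G.
          EC G c (step (u \<inter> V) (x \<union> y)) (g (x \<union> y)) \<le> enat (level u)) \<longleftrightarrow>
        (\<forall>x. valid_input expanded u x \<longrightarrow> (\<exists>y\<subseteq>outputs G.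
          EC G c (step (u \<inter> V) (x \<union> y)) (g (x \<union> y)) \<le> enat (level u)))"
      using dead by metis
    then show ?thesis
      unfolding ECpre_le_iff by (simp add: step_iff[OF u] cong: imp_cong)
  qed
  then show ?thesis
    by (auto simp: upper_def states_expanded)
qed

text \<open>An infimum in \<open>enat\<close> is attained, so a bound on it is a bound on some
  stage.\<close>

lemma upper_INF: "upper (\<lambda>s. INF i::nat. h i s) = (\<Union>i. upper (h i))"
proof -
  have "(INF i::nat. h i s) \<le> enat k \<longleftrightarrow> (\<exists>i. h i s \<le> enat k)" for s k
  proof
    assume "(INF i. h i s) \<le> enat k"
    moreover have "(INF i. h i s) \<in> range (\<lambda>i. h i s)"
      by (rule wellorder_InfI[of "h 0 s"]) simp
    ultimately show "\<exists>i. h i s \<le> enat k"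
      by auto
  qed (blast intro: INF_lower2)
  then show ?thesis
    by (auto simp: upper_def)
qed

lemma upper_SUP: "upper (\<lambda>s. SUP i::nat. h i s) = (\<Inter>i. upper (h i))"
  by (auto simp: upper_def SUP_le_iff)

lemma credit_valued_INF:
  assumes "\<And>i::nat. credit_valued (h i)"
  shows "credit_valued (\<lambda>s. INF i. h i s)"
  unfolding credit_valued_def
proof
  fix s
  assume "s \<in> states G"
  moreover have "(INF i. h i s) \<in> range (\<lambda>i. h i s)"
    by (rule wellorder_InfI[of "h 0 s"]) simp
  ultimately show "(INF i. h i s) \<le> enat c \<or> (INF i. h i s) = \<infinity>"
    using assms unfolding credit_valued_def by (metis rangeE)
qed

lemma credit_valued_SUP:
  assumes "\<And>i::nat. credit_valued (h i)"
  shows "credit_valued (\<lambda>s. SUP i. h i s)"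
  unfolding credit_valued_def
proof
  fix s
  assume "s \<in> states G"
  then have "h i s \<le> enat c \<or> h i s = \<infinity>" for i
    using assms by (auto simp: credit_valued_def)
  moreover have "(SUP i. h i s) = \<infinity>" if "h i s = \<infinity>" for i
    using SUP_upper[of i UNIV "\<lambda>i. h i s"] that by simp
  ultimately show "(SUP i. h i s) \<le> enat c \<or> (SUP i. h i s) = \<infinity>"
    by (metis SUP_least)
qed

text \<open>The valuations can be required to correspond on free variables only: closed formulas
  start from \<open>{}\<close> on one side and from the constant 0 on the other, whose
  \<open>upper\<close> is the set of all states. \<open>credit_valued\<close> is carried through the
  induction for \<open>upper_ECpre\<close>; \<open>mu_vars a \<subseteq> V\<close> makes literals
  independent of the level.\<close>

lemma mu_sem_expanded:
  assumes "sys_mu a" "mu_vars a \<subseteq> V"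
    and "\<And>X. X \<in> free_rels a \<Longrightarrow> E X = upper (D X) \<and> credit_valued (D X)"
  shows "mu_sem expanded a E = upper (emu_sem G c (to_energy a) D) \<and>
    credit_valued (emu_sem G c (to_energy a) D)"
  using assms
proof (induction a arbitrary: E D)
  case (MOr a b)
  then have "mu_sem expanded a E = upper (emu_sem G c (to_energy a) D) \<and>
      credit_valued (emu_sem G c (to_energy a) D)"
    "mu_sem expanded b E = upper (emu_sem G c (to_energy b) D) \<and>
      credit_valued (emu_sem G c (to_energy b) D)"
    by simp_all
  then show ?case
    by (auto simp: upper_def credit_valued_def min_def)
next
  case (MAnd a b)
  then have "mu_sem expanded a E = upper (emu_sem G c (to_energy a) D) \<and>
      credit_valued (emu_sem G c (to_energy a) D)"
    "mu_sem expanded b E = upper (emu_sem G c (to_energy b) D) \<and>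
      credit_valued (emu_sem G c (to_energy b) D)"
    by simp_all
  then show ?case
    by (auto simp: upper_def credit_valued_def max_def)
next
  case (MDia a)
  then have "mu_sem expanded a E = upper (emu_sem G c (to_energy a) D)"
    "credit_valued (emu_sem G c (to_energy a) D)"
    by simp_all
  then show ?case
    by (simp add: upper_ECpre credit_valued_ECpre)
next
  case (Mu X a)
  let ?F = "\<lambda>S. mu_sem expanded a (E(X := S))"
  let ?H = "\<lambda>h. emu_sem G c (to_energy a) (D(X := h))"
  have step: "?F (upper h) = upper (?H h) \<and> credit_valued (?H h)" if "credit_valued h" for h
  proof (rule Mu.IH)
    show "(E(X := upper h)) Y = upper ((D(X := h)) Y) \<and> credit_valued ((D(X := h)) Y)"
      if "Y \<in> free_rels a" for Y
      using Mu.prems(3)[of Y] \<open>credit_valued h\<close> that by (cases "Y = X") simp_all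
  qed (use Mu.prems in simp_all)
  \<comment> \<open>By the reversed order the constant \<open>\<infinity>\<close> is the bottom: its
    \<open>upper\<close> is empty.\<close>
  have iter: "(?F ^^ i) {} = upper ((?H ^^ i) (\<lambda>_. \<infinity>)) \<and> credit_valued ((?H ^^ i) (\<lambda>_. \<infinity>))" for i
  proof (induction i)
    case 0
    then show ?case by (simp add: upper_def credit_valued_def)
  next
    case (Suc i)
    then show ?case using step by (simp only: funpow.simps o_apply simp_thms)
  qed
  have "mono ?F"
    by (intro monoI mu_sem_mono) auto
  moreover have "finite (states expanded)"
    using finite_V fin_Z by (simp add: states_def)
  moreover have "(?F ^^ i) {} \<subseteq> states expanded" for i
    using iter by (auto simp: upper_def)
  ultimately have "mu_sem expanded (Mu X a) E = (\<Union>i. (?F ^^ i) {})"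
    unfolding mu_sem.simps by (intro least_prefixpoint_eq_UN)
  then show ?case
    using iter by (simp add: upper_INF credit_valued_INF)
next
  case (Nu X a)
  let ?F = "\<lambda>S. mu_sem expanded a (E(X := S))"
  let ?H = "\<lambda>h. emu_sem G c (to_energy a) (D(X := h))"
  have step: "?F (upper h) = upper (?H h) \<and> credit_valued (?H h)" if "credit_valued h" for h
  proof (rule Nu.IH)
    show "(E(X := upper h)) Y = upper ((D(X := h)) Y) \<and> credit_valued ((D(X := h)) Y)"
      if "Y \<in> free_rels a" for Y
      using Nu.prems(3)[of Y] \<open>credit_valued h\<close> that by (cases "Y = X") simp_all
  qed (use Nu.prems in simp_all)
  have iter: "(?F ^^ i) (states expanded) = upper ((?H ^^ i) (\<lambda>_. 0)) \<and>
      credit_valued ((?H ^^ i) (\<lambda>_. 0))" for i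
  proof (induction i)
    case 0
    then show ?case by (simp add: upper_def credit_valued_def)
  next
    case (Suc i)
    then show ?case using step by (simp only: funpow.simps o_apply simp_thms)
  qed
  have "mono ?F"
    by (intro monoI mu_sem_mono) auto
  moreover have "finite (states expanded)"
    using finite_V fin_Z by (simp add: states_def)
  moreover have "?F (states expanded) \<subseteq> states expanded"
    using iter[of 1] by (auto simp: upper_def)
  ultimately have "mu_sem expanded (Nu X a) E = (\<Inter>i. (?F ^^ i) (states expanded))"
    unfolding mu_sem.simps by (intro greatest_postfixpoint_eq_INT)
  then show ?case
    using iter by (simp add: upper_SUP credit_valued_SUP)
qed (auto simp: upper_def credit_valued_def)


section \<open>Winning in the expanded game structure\<close>

abbreviation energy :: "nat \<Rightarrow> 'v set list \<Rightarrow> int" where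
  "energy \<equiv> energy_level G (enat c)"

lemma energy_snoc:
  "h \<noteq> [] \<Longrightarrow> energy e (h @ [t]) = min (int c) (energy e h + the (weight G (step (last h) t)))"
  by (simp add: energy_level_snoc cap_def)

lemma energy_le: "energy e h \<le> int c" if "e \<le> c" "h \<noteq> []"
proof (cases h rule: rev_cases)
  case (snoc k t)
  then show ?thesis
    using that by (cases "k = []") (simp_all add: energy_snoc)
qed (use that in simp)

lemma sys_wins_expanded_iff:
  "sys_wins expanded u \<longleftrightarrow> (\<exists>f. sys_strategy_from expanded u f \<and>
     (\<forall>h. consistent_history expanded f u h \<longrightarrow>
        (\<forall>x. valid_input expanded (last h) x \<longrightarrow> f h x \<noteq> None)) \<and>
     (\<forall>\<sigma>. (\<forall>n. consistent_history expanded f u (map \<sigma> [0..<Suc n])) \<longrightarrow> \<sigma> \<in> wincond G))"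
  if "u \<in> states expanded"
  using all_plays_win_iff[of expanded u _ "\<lambda>_. True"] inputs_subset that
  unfolding sys_wins_def by (simp add: le_supI1 cong: conj_cong del: upt_Suc)

lemma sys_wins_energy_iff:
  "sys_wins_energy G (enat c) e s \<longleftrightarrow> (\<exists>f. sys_strategy_from G s f \<and>
     (\<forall>h. consistent_history G f s h \<longrightarrow>
        0 \<le> energy e h \<and> (\<forall>x. valid_input G (last h) x \<longrightarrow> f h x \<noteq> None)) \<and>
     (\<forall>\<sigma>. (\<forall>n. consistent_history G f s (map \<sigma> [0..<Suc n])) \<longrightarrow> \<sigma> \<in> wincond G))"
  if "s \<in> states G"
  using all_plays_win_iff[of G s _ "\<lambda>h. 0 \<le> energy e h"] inputs_subset that
  unfolding sys_wins_energy_def play_wins_energy_def by (simp cong: conj_cong del: upt_Suc)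

text \<open>The winning condition is over \<open>V\<close>, so erasing the level variables does not
  change membership.\<close>

lemma wincond_restrict:
  assumes "\<And>n. map \<sigma> [0..<Suc n] = map (\<lambda>u. u \<inter> V) (map \<tau> [0..<Suc n])"
  shows "\<sigma> \<in> wincond G \<longleftrightarrow> \<tau> \<in> wincond G"
proof (rule omega_regular_over_cong)
  show "omega_regular_over V (wincond G)"
    using gs by (simp add: game_structure_def)
  show "\<sigma> i \<inter> V = \<tau> i \<inter> V" for i
    using assms[of i] by simp
qed

lemma sys_wins_energy_if_sys_wins_expanded:
  assumes u: "u \<in> states expanded" and win: "sys_wins expanded u"
  shows "sys_wins_energy G (enat c) (level u) (u \<inter> V)"
proof -
  let ?s = "u \<inter> V"
  have s: "?s \<in> states G"
    by (simp add: states_def)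
  obtain f where f: "sys_strategy_from expanded u f"
    and total: "\<And>h x. consistent_history expanded f u h \<Longrightarrow> valid_input expanded (last h) x \<Longrightarrow> f h x \<noteq> None"
    and inf: "\<And>\<sigma>. (\<And>n. consistent_history expanded f u (map \<sigma> [0..<Suc n])) \<Longrightarrow> \<sigma> \<in> wincond G"
    using win sys_wins_expanded_iff[OF u] by blast
  have strat: "sys_strategy expanded f"
    using f by (simp add: sys_strategy_from_def)
  \<comment> \<open>Only an inequality, as the given strategy may discard energy. The level is a
    lower bound for the true energy, and being a natural number it already forces that energy to be
    nonnegative.\<close>
  define R where "R h k \<longleftrightarrow> k = map (\<lambda>u. u \<inter> V) h \<and> int (level (last h)) \<le> energy (level u) k" for h k
  have last_R: "last k = last h \<inter> V" if "R h k" "consistent_history expanded f u h" for h k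
    using that consistent_history_not_Nil[OF that(2)] by (auto simp: R_def last_map)
  have R_output: "\<exists>z. valid_output G (last k) x z \<and> R (h @ [x \<union> y]) (k @ [x \<union> z])"
    if h: "consistent_history expanded f u h" and R: "R h k"
      and x: "valid_input G (last k) x" and y: "f h x = Some y" for h k x y
  proof -
    have ne: "h \<noteq> []" "k \<noteq> []"
      using consistent_history_not_Nil[OF h] R by (auto simp: R_def)
    have last_h: "last h \<subseteq> V \<union> Z"
      using consistent_history_states[OF h] last_in_set[OF ne(1)] states_expanded by blast
    have xi: "x \<subseteq> inputs G"
      using x by (simp add: valid_input_def)
    have "valid_output expanded (last h) x y"
      using strat y by (auto simp: sys_strategy_def)
    then have vo: "valid_output G (last k) x (y \<inter> V)"
      "int (level (x \<union> y)) \<le> int (level (last h)) + the (weight G (step (last k) (x \<union> (y \<inter> V))))"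
      by (simp_all add: valid_output_expanded[OF last_h xi] last_R[OF R h])
    have "(x \<union> y) \<inter> V = x \<union> (y \<inter> V)"
      using xi inputs_subset by blast
    \<comment> \<open>The new level respects the weight by \<open>vo(2)\<close> and the cap by
      \<open>level_le\<close>, hence the minimum of the two.\<close>
    moreover have "int (level (x \<union> y)) \<le> energy (level u) (k @ [x \<union> (y \<inter> V)])"
      unfolding energy_snoc[OF ne(2)] using R vo(2) level_le[of "x \<union> y"] by (auto simp: R_def)
    ultimately have "R (h @ [x \<union> y]) (k @ [x \<union> (y \<inter> V)])"
      using R by (simp add: R_def)
    then show ?thesis
      using vo(1) by blast
  qed
  obtain g where g: "sys_strategy_from G ?s g"
    "\<And>k x. consistent_history G g ?s k \<Longrightarrow> valid_input G (last k) x \<Longrightarrow> g k x \<noteq> None"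
    "\<And>k. consistent_history G g ?s k \<Longrightarrow> \<exists>h. consistent_history expanded f u h \<and> R h k"
    "\<And>\<sigma>. (\<And>n. consistent_history G g ?s (map \<sigma> [0..<Suc n])) \<Longrightarrow>
       \<exists>\<tau>. \<forall>n. consistent_history expanded f u (map \<tau> [0..<Suc n]) \<and>
         R (map \<tau> [0..<Suc n]) (map \<sigma> [0..<Suc n])"
  proof (rule strategy_transfer[where A = expanded and B = G and f = f and a = u and b = ?s and R = R])
    show "R [u] [?s]"
      by (simp add: R_def)
    show "valid_input expanded (last h) x"
      if "consistent_history expanded f u h" "R h k" "valid_input G (last k) x" for h k x
      using that last_R by (simp add: valid_input_expanded)
  qed (use strat total u s inputs_subset R_output in \<open>auto simp del: upt_Suc\<close>)
  have "0 \<le> energy (level u) k" if "consistent_history G g ?s k" for k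
    using g(3)[OF that] by (auto simp: R_def)
  moreover have "\<sigma> \<in> wincond G" if \<sigma>: "\<And>n. consistent_history G g ?s (map \<sigma> [0..<Suc n])" for \<sigma>
  proof -
    obtain \<tau> where \<tau>: "\<And>n. consistent_history expanded f u (map \<tau> [0..<Suc n])"
      "\<And>n. R (map \<tau> [0..<Suc n]) (map \<sigma> [0..<Suc n])"
      using g(4)[OF \<sigma>] by blast
    show ?thesis
      using inf[OF \<tau>(1)] wincond_restrict \<tau>(2) unfolding R_def by blast
  qed
  ultimately show ?thesis
    using sys_wins_energy_iff[OF s] g(1,2) by blast
qed

lemma sys_wins_expanded_if_sys_wins_energy:
  assumes u: "u \<in> states expanded" and win: "sys_wins_energy G (enat c) (level u) (u \<inter> V)"
  shows "sys_wins expanded u"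
proof -
  let ?s = "u \<inter> V"
  have s: "?s \<in> states G"
    by (simp add: states_def)
  obtain f where f: "sys_strategy_from G ?s f"
    and nonneg: "\<And>h. consistent_history G f ?s h \<Longrightarrow> 0 \<le> energy (level u) h"
    and total: "\<And>h x. consistent_history G f ?s h \<Longrightarrow> valid_input G (last h) x \<Longrightarrow> f h x \<noteq> None"
    and inf: "\<And>\<sigma>. (\<And>n. consistent_history G f ?s (map \<sigma> [0..<Suc n])) \<Longrightarrow> \<sigma> \<in> wincond G"
    using win sys_wins_energy_iff[OF s] by blast
  have strat: "sys_strategy G f"
    using f by (simp add: sys_strategy_from_def)
  \<comment> \<open>Here the levels are picked by the strategy under construction, so they can
    record the energy exactly.\<close>
  define R where "R h k \<longleftrightarrow> h = map (\<lambda>u. u \<inter> V) k \<and> int (level (last k)) = energy (level u) h" for h k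
  have last_R: "last h = last k \<inter> V" if "R h k" "consistent_history G f ?s h" for h k
    using that consistent_history_not_Nil[OF that(2)] by (auto simp: R_def last_map)
  have R_output: "\<exists>z. valid_output expanded (last k) x z \<and> R (h @ [x \<union> y]) (k @ [x \<union> z])"
    if h: "consistent_history G f ?s h" and k: "history_from expanded u k" and R: "R h k"
      and x: "valid_input expanded (last k) x" and y: "f h x = Some y" for h k x y
  proof -
    have ne: "h \<noteq> []" "k \<noteq> []"
      using consistent_history_not_Nil[OF h] R by (auto simp: R_def)
    have last_k: "last k \<subseteq> V \<union> Z"
      using k last_in_set[OF ne(2)] states_expanded unfolding history_from_def by blast
    have xi: "x \<subseteq> inputs G"
      using x by (simp add: valid_input_def)
    have vo: "valid_output G (last h) x y"
      using strat y by (auto simp: sys_strategy_def)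
    then have xy: "x \<union> y \<subseteq> V" and yo: "y \<subseteq> outputs G"
      using xi inputs_subset by (auto simp: valid_output_def outputs_def)
    let ?e = "energy (level u) (h @ [x \<union> y])"
    have "valid_input G (last h) x"
      using x by (simp add: valid_input_expanded last_R[OF R h])
    \<comment> \<open>The prolonged history is consistent with the winning \<open>f\<close>, so its
      energy is nonnegative; together with the cap it is a value that a level can take.\<close>
    then have e: "0 \<le> ?e"
      using consistent_history_snoc[OF inputs_subset strat h _ y] nonneg by blast
    moreover have "?e \<le> int c"
      using energy_le level_le by blast
    ultimately obtain Y where Y: "Y \<subseteq> Z" "level (x \<union> y \<union> Y) = nat ?e"
      using ex_level[of "nat ?e"] xy by (metis nat_le_iff)
    have eq: "(y \<union> Y) \<inter> V = y" "(x \<union> (y \<union> Y)) \<inter> V = x \<union> y"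
      using xy Y(1) disj by blast+
    have lev: "int (level (x \<union> (y \<union> Y))) = ?e"
      using Y(2) e by (simp add: Un_assoc)
    have "valid_output expanded (last k) x (y \<union> Y)"
      unfolding valid_output_expanded[OF last_k xi] eq lev
      using vo yo Y(1) R energy_snoc[OF ne(1)] by (auto simp: last_R[OF R h, symmetric] R_def)
    moreover have "R (h @ [x \<union> y]) (k @ [x \<union> (y \<union> Y)])"
      using R lev eq by (simp add: R_def)
    ultimately show ?thesis
      by blast
  qed
  obtain g where g: "sys_strategy_from expanded u g"
    "\<And>k x. consistent_history expanded g u k \<Longrightarrow> valid_input expanded (last k) x \<Longrightarrow> g k x \<noteq> None"
    "\<And>\<sigma>. (\<And>n. consistent_history expanded g u (map \<sigma> [0..<Suc n])) \<Longrightarrow>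
       \<exists>\<tau>. \<forall>n. consistent_history G f ?s (map \<tau> [0..<Suc n]) \<and>
         R (map \<tau> [0..<Suc n]) (map \<sigma> [0..<Suc n])"
  proof (rule strategy_transfer[where A = G and B = expanded and f = f and a = ?s and b = u and R = R])
    show "R [?s] [u]"
      by (simp add: R_def)
    show "valid_input G (last h) x"
      if "consistent_history G f ?s h" "R h k" "valid_input expanded (last k) x" for h k x
      using that last_R by (simp add: valid_input_expanded)
  qed (use strat total u s inputs_subset R_output in \<open>auto simp del: upt_Suc\<close>)
  have "\<sigma> \<in> wincond G" if \<sigma>: "\<And>n. consistent_history expanded g u (map \<sigma> [0..<Suc n])" for \<sigma>
  proof -
    obtain \<tau> where \<tau>: "\<And>n. consistent_history G f ?s (map \<tau> [0..<Suc n])"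
      "\<And>n. R (map \<tau> [0..<Suc n]) (map \<sigma> [0..<Suc n])"
      using g(3)[OF \<sigma>] by blast
    show ?thesis
      using inf[OF \<tau>(1)] wincond_restrict \<tau>(2) unfolding R_def by blast
  qed
  then show ?thesis
    using sys_wins_expanded_iff[OF u] g(1,2) by blast
qed

lemma winning_credits_eq:
  assumes "s \<in> states G" "mu_sem_closed expanded \<psi> = {u \<in> states expanded. sys_wins expanded u}"
    and "sys_mu \<psi>" "closed_mu \<psi>" "mu_vars \<psi> \<subseteq> V"
  shows "winning_credits G (enat c) s = {e. e \<le> c \<and> emu_sem_closed G c (to_energy \<psi>) s \<le> enat e}"
proof -
  have sem: "mu_sem_closed expanded \<psi> = upper (emu_sem_closed G c (to_energy \<psi>))"
    unfolding mu_sem_closed_def emu_sem_closed_def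
    using mu_sem_expanded[OF assms(3,5)] assms(4) by (simp add: closed_mu_def)
  have "sys_wins_energy G (enat c) e s \<longleftrightarrow> emu_sem_closed G c (to_energy \<psi>) s \<le> enat e" if "e \<le> c" for e
  proof -
    have sV: "s \<subseteq> V"
      using assms(1) by (simp add: states_def)
    \<comment> \<open>The initial credit becomes the level of the initial state.\<close>
    obtain Y where Y: "Y \<subseteq> Z" "level (s \<union> Y) = e"
      using ex_level[OF \<open>e \<le> c\<close>] sV by blast
    have u: "s \<union> Y \<in> states expanded" "(s \<union> Y) \<inter> V = s"
      using Y sV disj by (auto simp: states_expanded)
    have "sys_wins_energy G (enat c) e s \<longleftrightarrow> s \<union> Y \<in> mu_sem_closed expanded \<psi>"
      using sys_wins_energy_if_sys_wins_expanded[OF u(1)] sys_wins_expanded_if_sys_wins_energy[OF u(1)]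
        u Y(2) assms(2) by auto
    then show ?thesis
      using u Y(2) by (simp add: sem upper_def)
  qed
  then show ?thesis
    by (auto simp: winning_credits_def)
qed

text \<open>A finite value above \<open>c\<close> would leave no winning credit at all; this bound
  makes a finite value itself a winning credit.\<close>

lemma emu_sem_closed_range:
  assumes "s \<in> states G" "sys_mu \<psi>" "closed_mu \<psi>" "mu_vars \<psi> \<subseteq> V"
  shows "emu_sem_closed G c (to_energy \<psi>) s \<le> enat c \<or> emu_sem_closed G c (to_energy \<psi>) s = \<infinity>"
  using mu_sem_expanded[of \<psi> "\<lambda>_. {}" "\<lambda>_ _. 0"] assms
  by (auto simp: closed_mu_def emu_sem_closed_def credit_valued_def)

end

theorem theorem3p6:
  fixes \<phi> :: "(nat \<Rightarrow> 'v :: infinite set) set"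
    and \<psi> :: "('v, 'x) mu"
    and G :: "'v wgs"
    and c :: nat
    and s :: "'v set"
  assumes "omega_regular \<phi>"
    and "sys_mu \<psi>" and "closed_mu \<psi>" and "matches \<psi> \<phi>"
    and "weighted_game_structure G" and "wincond G = \<phi>"
    and "mu_vars \<psi> \<subseteq> gvars G"
    and "s \<in> states G"
  shows "(emu_sem_closed G c (to_energy \<psi>) s \<noteq> \<infinity> \<longrightarrow>
            (\<exists>c0. emu_sem_closed G c (to_energy \<psi>) s = enat c0 \<and>
               c0 \<in> winning_credits G (enat c) s \<and>
               (\<forall>c1\<in>winning_credits G (enat c) s. c0 \<le> c1))) \<and>
         (emu_sem_closed G c (to_energy \<psi>) s = \<infinity> \<longrightarrow>
            winning_credits G (enat c) s = {})"
proof -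
  have fin: "finite (gvars G)"
    using assms(5) by (simp add: weighted_game_structure_def game_structure_def)
  \<comment> \<open>The infinite type supplies \<open>c\<close> fresh variables for every
    \<open>c\<close>.\<close>
  then have "infinite (- gvars G)"
    by (simp add: Compl_eq_Diff_UNIV infinite_UNIV)
  then obtain Z where Z: "Z \<subseteq> - gvars G" "card Z = c" "finite Z"
    using infinite_arbitrarily_large by blast
  then interpret energy_expansion G c Z
    using assms(5) by unfold_locales auto
  \<comment> \<open>The matching assumption is applied here, to the expanded game: it has the
    condition \<phi> and contains the variables of \<psi>.\<close>
  have "mu_sem_closed expanded \<psi> = {u \<in> states expanded. sys_wins expanded u}"
    using assms(4,6,7) game_structure_expanded unfolding matches_def by (metis expanded_simps(1,5) le_supI1)
  from winning_credits_eq[OF assms(8) this assms(2,3,7)]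
  have credits: "winning_credits G (enat c) s = {e. e \<le> c \<and> emu_sem_closed G c (to_energy \<psi>) s \<le> enat e}" .
  show ?thesis
    using emu_sem_closed_range[OF assms(8,2,3,7)] unfolding credits
    by (cases "emu_sem_closed G c (to_energy \<psi>) s") auto
qed

end
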